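(* Let $v(x)=\sum_{\omega\in\Delta(x)}\bar{\mathbb P}(\omega)$, and let $\mathbb Q$ be the path measure built from $v$ and $L_{\mathbb Q}=\mathbb P/\mathbb Q$ the likelihood ratio (see context). Then the estimator based on $v$ and $\mathbb Q$ has vanishing relative error: $$\lim_{\epsilon\downarrow0}\frac{\operatorname{Var}_{\mathbb Q}(L_{\mathbb Q}\cdot\mathbf 1_\Phi)}{\big(\mathbb E_{\mathbb Q}(L_{\mathbb Q}\cdot\mathbf 1_\Phi)\big)^2}=0.$$
   Context: Markov chain. $\mathcal X$ is a (possibly infinite) countable state space with distinguished states $s$ (initial), $g$ (goal), $t$ (taboo), $s\ne g$, $s\neq t$, and $g,t$ absorbing ($p_{gg}=p_{tt}=1$). The transition probabilities $p_{xz}=p_{xz}(\epsilon)$ depend on a small parameter $\epsilon>0$; for each $x,z$ either $p_{xz}=0$, and then $r_{xz}=\infty$, or $p_{xz}(\epsilon)>0$ with $p_{xz}(\epsilon)=\Theta(\epsilon^{r_{xz}})$ for some $r_{xz}\in\mathbb N=\{0,1,2,\dots\}$. The state space and its transition structure do not depend on $\epsilon$. Here $f=\Theta(h)$ means $0<\lim_{\epsilon\downarrow0}f(\epsilon)/h(\epsilon)<\infty$. Paths. A path $\omega$ is a finite sequence $\omega(0),\dots,\omega(n_\omega)$ of states, with $n_\omega\ge0$ steps, and $\mathbb P(\omega)=\prod_{i=1}^{n_\omega}p_{\omega(i-1)\omega(i)}$. Distance: $d(x,z)$ is the minimum of those $r\in\mathbb N$ for which there is a path $\omega$ with $\omega(0)=x$,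 $\omega(n_\omega)=z$, $\omega(k)\notin\{t,g\}$ for all $k<n_\omega$, and $\mathbb P(\omega)=\Theta(\epsilon^r)$; $d(x,z)=\infty$ if there is none. $\Phi(x)$ is the set of paths with $\omega(0)=x$, $\omega(n_\omega)=g$, $\omega(k)\notin\{t,g\}$ for $k<n_\omega$; $\Phi=\Phi(s)$. Sets. $\Lambda=\{x\in\mathcal X: d(s,x)\le d(s,g)\}$, $\Gamma=\{x\in\mathcal X\setminus\Lambda:\exists z\in\Lambda,\ p_{zx}>0\}$. Modified chain: $\bar p_{xz}=p_{xz}$ if $x\notin\Gamma$; $\bar p_{xg}=1$ and $\bar p_{xz}=0$ for $z\ne g$ if $x\in\Gamma$. $\bar{\mathbb P}$ and $\bar d$ are defined as $\mathbb P$ and $d$ with $\bar p$ in place of $p$. Dominant paths: $\Delta(x)=\{\omega\in\Phi(x):\bar{\mathbb P}(\omega)=\Theta(\epsilon^{\bar d(x,g)})\}$; if $\bar d(x,g)=\infty$ the sum over $\Delta(x)$ is $0$. (Only the values of $v$ on $\Lambda\cup\Gamma$ matter below.) Importance sampling measure. For a path $\omega$ let $m(\omega)=\min\{i:\omega(i)\notin\Lambda\text{ or }\omega(i)=g\}$ ($=\infty$ if there is no such $i$). Then $\mathbb Q(\omega)=\prod_{i=0}^{n_\omega-1}q_{\omega(i)\omega(i+1)}$, where $q_{\omega(i)\omega(i+1)}=\bar p_{\omega(i)\omega(i+1)}v(\omega(i+1))\big/\sum_{z\in\mathcal X}\bar p_{\omega(i)z}v(z)$ if $i<m(\omega)$,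 and $q_{\omega(i)\omega(i+1)}=p_{\omega(i)\omega(i+1)}$ if $i\ge m(\omega)$. (A path entering, before $m(\omega)$, a state where the denominator vanishes has $\mathbb Q(\omega)=0$.) A random path is drawn under $\mathbb Q$ from $s$ until it first hits $g$ or $t$; $\mathbf 1_\Phi$ indicates that it hits $g$; $L_{\mathbb Q}(\omega)=\mathbb P(\omega)/\mathbb Q(\omega)$. Expectation and variance under $\mathbb Q$ refer to this random path; e.g. $\mathbb E_{\mathbb Q}(L_{\mathbb Q}^k\mathbf 1_\Phi)=\sum_{\omega\in\Phi,\ \mathbb Q(\omega)>0}\mathbb Q(\omega)(\mathbb P(\omega)/\mathbb Q(\omega))^k$. Standing assumptions. $\Lambda$ and $\Gamma$ are finite; $d(s,g)<\infty$; under $\mathbb P$ the chain from $s$ reaches $\{t,g\}$ in finite time with probability 1; the chain has no high-probability cycle, i.e. no path with $n_\omega\ge1$, $\omega(n_\omega)=\omega(0)$ and $\mathbb P(\omega)=\Theta(\epsilon^0)$, other than the self-loops at the absorbing states $g,t$. *)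

theory Defs
  imports "HOL-Probability.Probability"
begin

(* The state space is a countable type 'a.  The family of chains is a map from the
   parameter \<epsilon> to a kernel 'a \<Rightarrow> 'a pmf; only its values for small \<epsilon> > 0 matter.
   A path is a non-empty list \<omega> with length \<omega> - 1 steps. *)

type_synonym 'a kernel_family = "real \<Rightarrow> 'a \<Rightarrow> 'a pmf"

(* Unlike bigtheta of the Landau symbols, this requires the limit of the quotient to exist. *)
definition is_Theta :: "(real \<Rightarrow> real) \<Rightarrow> (real \<Rightarrow> real) \<Rightarrow> bool" where
  "is_Theta f h \<longleftrightarrow> (\<exists>c>0. ((\<lambda>\<epsilon>. f \<epsilon> / h \<epsilon>) \<longlongrightarrow> c) (at_right 0))"

definition path_prob :: "('a \<Rightarrow> 'a pmf) \<Rightarrow> 'a list \<Rightarrow> real" where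
  "path_prob K \<omega> = (\<Prod>i<length \<omega> - 1. pmf (K (\<omega> ! i)) (\<omega> ! Suc i))"

definition paths_between :: "'a \<Rightarrow> 'a \<Rightarrow> 'a \<Rightarrow> 'a \<Rightarrow> 'a list set" where
  "paths_between g t x z =
     {\<omega>. \<omega> \<noteq> [] \<and> hd \<omega> = x \<and> last \<omega> = z \<and> (\<forall>k<length \<omega> - 1. \<omega> ! k \<notin> {t, g})}"

(* The infimum of the empty set is \<infinity> in enat. *)
definition path_dist :: "'a kernel_family \<Rightarrow> 'a \<Rightarrow> 'a \<Rightarrow> 'a \<Rightarrow> 'a \<Rightarrow> enat" where
  "path_dist p g t x z =
     Inf {enat r | r. \<exists>\<omega>\<in>paths_between g t x z.
            is_Theta (\<lambda>\<epsilon>. path_prob (p \<epsilon>) \<omega>) (\<lambda>\<epsilon>. \<epsilon> ^ r)}"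

definition \<Phi> :: "'a \<Rightarrow> 'a \<Rightarrow> 'a \<Rightarrow> 'a list set" where
  "\<Phi> g t x = paths_between g t x g"

definition \<Lambda> :: "'a kernel_family \<Rightarrow> 'a \<Rightarrow> 'a \<Rightarrow> 'a \<Rightarrow> 'a set" where
  "\<Lambda> p s g t = {x. path_dist p g t s x \<le> path_dist p g t s g}"

(* The transition structure does not depend on \<epsilon>, so positivity for small \<epsilon> is positivity. *)
definition \<Gamma> :: "'a kernel_family \<Rightarrow> 'a \<Rightarrow> 'a \<Rightarrow> 'a \<Rightarrow> 'a set" where
  "\<Gamma> p s g t =
     {x. x \<notin> \<Lambda> p s g t \<and> (\<exists>z\<in>\<Lambda> p s g t. \<forall>\<^sub>F \<epsilon> in at_right 0. pmf (p \<epsilon> z) x > 0)}"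

definition pbar :: "'a kernel_family \<Rightarrow> 'a \<Rightarrow> 'a \<Rightarrow> 'a \<Rightarrow> 'a kernel_family" where
  "pbar p s g t \<epsilon> x = (if x \<in> \<Gamma> p s g t then return_pmf g else p \<epsilon> x)"

definition dbar :: "'a kernel_family \<Rightarrow> 'a \<Rightarrow> 'a \<Rightarrow> 'a \<Rightarrow> 'a \<Rightarrow> 'a \<Rightarrow> enat" where
  "dbar p s g t x z = path_dist (pbar p s g t) g t x z"

definition \<Delta> :: "'a kernel_family \<Rightarrow> 'a \<Rightarrow> 'a \<Rightarrow> 'a \<Rightarrow> 'a \<Rightarrow> 'a list set" where
  "\<Delta> p s g t x =
     {\<omega> \<in> \<Phi> g t x. \<exists>r. dbar p s g t x g = enat r \<and>
        is_Theta (\<lambda>\<epsilon>. path_prob (pbar p s g t \<epsilon>) \<omega>) (\<lambda>\<epsilon>. \<epsilon> ^ r)}"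

definition v :: "'a kernel_family \<Rightarrow> 'a \<Rightarrow> 'a \<Rightarrow> 'a \<Rightarrow> real \<Rightarrow> 'a \<Rightarrow> real" where
  "v p s g t \<epsilon> x = (\<Sum>\<^sub>\<infinity>\<omega>\<in>\<Delta> p s g t x. path_prob (pbar p s g t \<epsilon>) \<omega>)"

definition exit_time :: "'a kernel_family \<Rightarrow> 'a \<Rightarrow> 'a \<Rightarrow> 'a \<Rightarrow> 'a list \<Rightarrow> enat" where
  "exit_time p s g t \<omega> =
     Inf {enat i | i. i < length \<omega> \<and> (\<omega> ! i \<notin> \<Lambda> p s g t \<or> \<omega> ! i = g)}"

(* Where the denominator vanishes, the quotient is 0, so the path has probability 0. *)
definition q_step :: "'a kernel_family \<Rightarrow> 'a \<Rightarrow> 'a \<Rightarrow> 'a \<Rightarrow> real \<Rightarrow> 'a list \<Rightarrow> nat \<Rightarrow> real" where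
  "q_step p s g t \<epsilon> \<omega> i =
     (if enat i < exit_time p s g t \<omega>
      then pmf (pbar p s g t \<epsilon> (\<omega> ! i)) (\<omega> ! Suc i) * v p s g t \<epsilon> (\<omega> ! Suc i) /
           (\<Sum>\<^sub>\<infinity>z. pmf (pbar p s g t \<epsilon> (\<omega> ! i)) z * v p s g t \<epsilon> z)
      else pmf (p \<epsilon> (\<omega> ! i)) (\<omega> ! Suc i))"

definition Q_prob :: "'a kernel_family \<Rightarrow> 'a \<Rightarrow> 'a \<Rightarrow> 'a \<Rightarrow> real \<Rightarrow> 'a list \<Rightarrow> real" where
  "Q_prob p s g t \<epsilon> \<omega> = (\<Prod>i<length \<omega> - 1. q_step p s g t \<epsilon> \<omega> i)"

definition stopped_paths :: "'a \<Rightarrow> 'a \<Rightarrow> 'a \<Rightarrow> 'a list set" where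
  "stopped_paths s g t = paths_between g t s g \<union> paths_between g t s t"

(* Law of the random path drawn under Q from s until it first hits g or t.  None stands for
   a run that never hits {g, t}; it carries whatever mass the stopped paths leave over, so
   that the law always has total mass 1. *)
definition Q_law :: "'a kernel_family \<Rightarrow> 'a \<Rightarrow> 'a \<Rightarrow> 'a \<Rightarrow> real \<Rightarrow> 'a list option measure" where
  "Q_law p s g t \<epsilon> = point_measure UNIV
     (\<lambda>w. case w of
        None \<Rightarrow> 1 - (\<integral>\<^sup>+\<omega>. ennreal (Q_prob p s g t \<epsilon> \<omega>) \<partial>count_space (stopped_paths s g t))
      | Some \<omega> \<Rightarrow> if \<omega> \<in> stopped_paths s g t then ennreal (Q_prob p s g t \<epsilon> \<omega>) else 0)"

definition likelihood_ratio :: "'a kernel_family \<Rightarrow> 'a \<Rightarrow> 'a \<Rightarrow> 'a \<Rightarrow> real \<Rightarrow> 'a list \<Rightarrow> real" where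
  "likelihood_ratio p s g t \<epsilon> \<omega> = path_prob (p \<epsilon>) \<omega> / Q_prob p s g t \<epsilon> \<omega>"

definition estimator :: "'a kernel_family \<Rightarrow> 'a \<Rightarrow> 'a \<Rightarrow> 'a \<Rightarrow> real \<Rightarrow> 'a list option \<Rightarrow> real" where
  "estimator p s g t \<epsilon> w = (case w of
      None \<Rightarrow> 0
    | Some \<omega> \<Rightarrow> likelihood_ratio p s g t \<epsilon> \<omega> * indicator (\<Phi> g t s) \<omega>)"

definition expectation_Q ::
    "'a kernel_family \<Rightarrow> 'a \<Rightarrow> 'a \<Rightarrow> 'a \<Rightarrow> real \<Rightarrow> ('a list option \<Rightarrow> real) \<Rightarrow> real" where
  "expectation_Q p s g t \<epsilon> X = (\<integral>w. X w \<partial>Q_law p s g t \<epsilon>)"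

(* Valued in ennreal, so that an infinite variance is \<infinity> rather than the default value 0 of
   the Bochner integral. *)
definition variance_Q ::
    "'a kernel_family \<Rightarrow> 'a \<Rightarrow> 'a \<Rightarrow> 'a \<Rightarrow> real \<Rightarrow> ('a list option \<Rightarrow> real) \<Rightarrow> ennreal" where
  "variance_Q p s g t \<epsilon> X =
     (\<integral>\<^sup>+w. ennreal ((X w - expectation_Q p s g t \<epsilon> X)\<^sup>2) \<partial>Q_law p s g t \<epsilon>)"

end

theory Submission
  imports Defs
begin

text \<open>For the modified chain, let \<open>w x\<close> be the sum of \<open>p x z * v z\<close> over all successors \<open>z\<close>, whereas
  \<open>v x\<close> is the same sum over the dominant successors only; hence \<open>w / v\<close> tends to 1 on the finite set
  \<open>\<Lambda>\<close>. The likelihood ratio of a path from \<open>s\<close> to \<open>g\<close> is \<open>v s\<close> times the product of \<open>w / v\<close> along the path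
  until it leaves \<open>\<Lambda>\<close>. Without high-probability cycles the dominant steps form an acyclic graph, so
  the rank in this graph is a Lyapunov function: for every \<open>\<eta> > 0\<close> and small \<open>\<epsilon>\<close>, the second moment
  of the estimator is at most \<open>(v s)\<^sup>2 * (1 + \<eta> * rank s)\<close>. The dominant paths from \<open>s\<close> avoid \<open>\<Gamma>\<close>, so
  they are dominant for the original chain as well and the first moment is at least \<open>v s\<close>. Therefore
  the squared relative error is at most \<open>\<eta> * rank s\<close>.\<close>

section \<open>Sums over count spaces and asymptotic orders\<close>

text \<open>Nonnegative sums are suprema of finite partial sums. So bounds for finite sets of paths,
  which allow induction on path length, pass to integrals over all paths.\<close>

lemma nn_integral_count_space_le:
  fixes f :: "'a \<Rightarrow> real"
  assumes nonneg: "\<And>x. x \<in> A \<Longrightarrow> 0 \<le> f x"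
    and le: "\<And>F. finite F \<Longrightarrow> F \<subseteq> A \<Longrightarrow> sum f F \<le> c"
  shows "(\<integral>\<^sup>+x. ennreal (f x) \<partial>count_space A) \<le> ennreal c"
proof -
  have summable: "f summable_on A"
    by (rule nonneg_bdd_above_summable_on) (use assms in \<open>auto intro!: bdd_aboveI2\<close>)
  then have abs: "Infinite_Set_Sum.abs_summable_on f A"
    using nonneg summable_on_cong[of A "\<lambda>x. norm (f x)" f]
    by (intro abs_summable_equivalent[THEN iffD1]) simp
  have "(\<integral>\<^sup>+x. ennreal (f x) \<partial>count_space A) = ennreal (infsetsum f A)"
    using abs nonneg by (rule nn_integral_conv_infsetsum)
  also have "infsetsum f A = infsum f A"
    using abs by (rule infsetsum_infsum)
  also have "infsum f A \<le> c"
    using summable le by (rule infsum_le_finite_sums)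
  finally show ?thesis by (simp add: ennreal_leI)
qed

lemma sum_le_nn_integral_count_space:
  fixes f :: "'a \<Rightarrow> real"
  assumes "finite F" "F \<subseteq> A" "\<And>x. x \<in> F \<Longrightarrow> 0 \<le> f x"
  shows "ennreal (sum f F) \<le> (\<integral>\<^sup>+x. ennreal (f x) \<partial>count_space A)"
proof -
  have "ennreal (sum f F) = (\<integral>\<^sup>+x. ennreal (f x) \<partial>count_space F)"
    using assms by (simp add: nn_integral_count_space_finite sum_ennreal)
  also have "\<dots> \<le> (\<integral>\<^sup>+x. ennreal (f x) \<partial>count_space A)"
    using assms by (auto simp: nn_integral_count_space_indicator intro!: nn_integral_mono split: split_indicator)
  finally show ?thesis .
qed

lemma sum_pmf_le_1: "finite A \<Longrightarrow> (\<Sum>x\<in>A. pmf M x) \<le> 1"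
  by (metis measure_measure_pmf_finite measure_pmf.prob_le_1)

text \<open>If \<open>i < j\<close> were both orders of \<open>f\<close>, the quotient by
  \<open>\<epsilon> ^ i\<close> would be a convergent function times
  \<open>\<epsilon> ^ (j - i)\<close>, hence tend to 0 and not to a positive limit.\<close>

lemma is_Theta_power_unique:
  assumes "is_Theta f (\<lambda>\<epsilon>. \<epsilon> ^ m)" "is_Theta f (\<lambda>\<epsilon>. \<epsilon> ^ n)"
  shows "m = n"
proof -
  have False if less: "i < j" and i: "is_Theta f (\<lambda>\<epsilon>. \<epsilon> ^ i)" and j: "is_Theta f (\<lambda>\<epsilon>. \<epsilon> ^ j)"
    for i j :: nat
  proof -
    from i obtain c where c: "c > 0" "((\<lambda>\<epsilon>. f \<epsilon> / \<epsilon> ^ i) \<longlongrightarrow> c) (at_right 0)"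
      by (auto simp: is_Theta_def)
    from j obtain d where d: "((\<lambda>\<epsilon>. f \<epsilon> / \<epsilon> ^ j) \<longlongrightarrow> d) (at_right 0)"
      by (auto simp: is_Theta_def)
    have "((\<lambda>\<epsilon>::real. \<epsilon> ^ (j - i)) \<longlongrightarrow> 0 ^ (j - i)) (at_right 0)"
      by (intro tendsto_intros)
    then have "((\<lambda>\<epsilon>. f \<epsilon> / \<epsilon> ^ j * \<epsilon> ^ (j - i)) \<longlongrightarrow> d * 0) (at_right 0)"
      using less by (intro tendsto_mult d) (simp add: power_0_left)
    moreover have "\<forall>\<^sub>F \<epsilon> in at_right 0. f \<epsilon> / \<epsilon> ^ j * \<epsilon> ^ (j - i) = f \<epsilon> / \<epsilon> ^ i"
      using eventually_at_right_less[of 0]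
    proof eventually_elim
      case (elim \<epsilon>)
      have "\<epsilon> ^ j = \<epsilon> ^ i * \<epsilon> ^ (j - i)"
        using less by (simp flip: power_add)
      then show ?case using elim by simp
    qed
    ultimately have "((\<lambda>\<epsilon>. f \<epsilon> / \<epsilon> ^ i) \<longlongrightarrow> 0) (at_right 0)"
      by (simp add: Lim_transform_eventually)
    from tendsto_unique[OF trivial_limit_at_right_real c(2) this] c(1) show False
      by simp
  qed
  then show ?thesis
    using assms by (metis linorder_neqE_nat)
qed

lemma is_Theta_power_mult:
  assumes "is_Theta f (\<lambda>\<epsilon>. \<epsilon> ^ m)" "is_Theta f' (\<lambda>\<epsilon>. \<epsilon> ^ n)"
  shows "is_Theta (\<lambda>\<epsilon>. f \<epsilon> * f' \<epsilon>) (\<lambda>\<epsilon>. \<epsilon> ^ (m + n))"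
proof -
  from assms obtain c d where "c > 0" "((\<lambda>\<epsilon>. f \<epsilon> / \<epsilon> ^ m) \<longlongrightarrow> c) (at_right 0)"
    "d > 0" "((\<lambda>\<epsilon>. f' \<epsilon> / \<epsilon> ^ n) \<longlongrightarrow> d) (at_right 0)"
    by (auto simp: is_Theta_def)
  moreover from this have "((\<lambda>\<epsilon>. (f \<epsilon> / \<epsilon> ^ m) * (f' \<epsilon> / \<epsilon> ^ n)) \<longlongrightarrow> c * d) (at_right 0)"
    by (intro tendsto_mult)
  ultimately show ?thesis
    unfolding is_Theta_def power_add by (intro exI[of _ "c * d"]) simp
qed

text \<open>The limit constants are positive, so no cancellation can raise the order of the
  sum.\<close>

lemma is_Theta_power_sum:
  assumes "finite A" "A \<noteq> {}" "\<And>x. x \<in> A \<Longrightarrow> is_Theta (f x) (\<lambda>\<epsilon>. \<epsilon> ^ n)"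
  shows "is_Theta (\<lambda>\<epsilon>. \<Sum>x\<in>A. f x \<epsilon>) (\<lambda>\<epsilon>. \<epsilon> ^ n)"
proof -
  from assms(3) have "\<forall>x\<in>A. \<exists>c>0. ((\<lambda>\<epsilon>. f x \<epsilon> / \<epsilon> ^ n) \<longlongrightarrow> c) (at_right 0)"
    by (auto simp: is_Theta_def)
  then obtain c where c: "\<And>x. x \<in> A \<Longrightarrow> c x > 0"
    "\<And>x. x \<in> A \<Longrightarrow> ((\<lambda>\<epsilon>. f x \<epsilon> / \<epsilon> ^ n) \<longlongrightarrow> c x) (at_right 0)"
    by metis
  then have "((\<lambda>\<epsilon>. \<Sum>x\<in>A. f x \<epsilon> / \<epsilon> ^ n) \<longlongrightarrow> (\<Sum>x\<in>A. c x)) (at_right 0)"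
    by (intro tendsto_sum)
  moreover have "(\<Sum>x\<in>A. c x) > 0"
    using assms c by (intro sum_pos)
  ultimately show ?thesis
    by (auto simp: is_Theta_def sum_divide_distrib)
qed

lemma is_Theta_power_divide_tendsto_0:
  assumes "is_Theta f (\<lambda>\<epsilon>. \<epsilon> ^ m)" "is_Theta f' (\<lambda>\<epsilon>. \<epsilon> ^ n)" "n < m"
  shows "((\<lambda>\<epsilon>. f \<epsilon> / f' \<epsilon>) \<longlongrightarrow> 0) (at_right 0)"
proof -
  from assms(1,2) obtain c d where c: "((\<lambda>\<epsilon>. f \<epsilon> / \<epsilon> ^ m) \<longlongrightarrow> c) (at_right 0)"
    and d: "d > 0" "((\<lambda>\<epsilon>. f' \<epsilon> / \<epsilon> ^ n) \<longlongrightarrow> d) (at_right 0)"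
    by (auto simp: is_Theta_def)
  have "((\<lambda>\<epsilon>. (f \<epsilon> / \<epsilon> ^ m) / (f' \<epsilon> / \<epsilon> ^ n) * \<epsilon> ^ (m - n)) \<longlongrightarrow> c / d * 0 ^ (m - n)) (at_right 0)"
    using d by (intro tendsto_intros c d(2)) auto
  moreover have "\<forall>\<^sub>F \<epsilon> in at_right 0.
      (f \<epsilon> / \<epsilon> ^ m) / (f' \<epsilon> / \<epsilon> ^ n) * \<epsilon> ^ (m - n) = f \<epsilon> / f' \<epsilon>"
    using eventually_at_right_less[of 0]
  proof eventually_elim
    case (elim \<epsilon>)
    have "\<epsilon> ^ m = \<epsilon> ^ n * \<epsilon> ^ (m - n)"
      using assms(3) by (simp flip: power_add)
    then show ?case using elim by simp
  qed
  ultimately show ?thesis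
    using assms(3) by (simp add: Lim_transform_eventually power_0_left)
qed

lemma is_Theta_power_eventually_pos:
  assumes "is_Theta f (\<lambda>\<epsilon>. \<epsilon> ^ n)"
  shows "\<forall>\<^sub>F \<epsilon> in at_right 0. 0 < f \<epsilon>"
proof -
  from assms obtain c where c: "c > 0" "((\<lambda>\<epsilon>. f \<epsilon> / \<epsilon> ^ n) \<longlongrightarrow> c) (at_right 0)"
    by (auto simp: is_Theta_def)
  from order_tendstoD(1)[OF c(2,1)] eventually_at_right_less[of 0] show ?thesis
    by eventually_elim (auto simp: zero_less_divide_iff)
qed

section \<open>Paths\<close>

lemma path_prob_singleton [simp]: "path_prob M [x] = 1"
  by (simp add: path_prob_def)

lemma path_prob_Cons:
  "l \<noteq> [] \<Longrightarrow> path_prob M (x # l) = pmf (M x) (hd l) * path_prob M l"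
  by (cases l) (simp_all add: path_prob_def prod.lessThan_Suc_shift del: prod.lessThan_Suc)

lemma path_prob_nonneg: "path_prob M \<omega> \<ge> 0"
  by (simp add: path_prob_def prod_nonneg)

lemma Nil_notin_paths_between [simp]: "[] \<notin> paths_between g t x z"
  by (simp add: paths_between_def)

text \<open>First-step decomposition of paths: one may continue only from a state other than
  \<open>g\<close> and \<open>t\<close>.\<close>

lemma Cons_in_paths_between_iff:
  "y # l \<in> paths_between g t x z \<longleftrightarrow>
     y = x \<and> (if l = [] then x = z else x \<notin> {g, t} \<and> l \<in> paths_between g t (hd l) z)"
proof (cases "l = []")
  case False
  then obtain n where n: "length l = Suc n"
    by (metis length_0_conv nat.exhaust)
  show ?thesis
    using False n by (auto simp: paths_between_def All_less_Suc2)
qed (auto simp: paths_between_def)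

lemma paths_between_absorbed:
  "x \<in> {g, t} \<Longrightarrow> (\<Union>z\<in>B. paths_between g t x z) \<subseteq> {[x]}"
proof
  fix \<omega> assume "x \<in> {g, t}" "\<omega> \<in> (\<Union>z\<in>B. paths_between g t x z)"
  then show "\<omega> \<in> {[x]}"
    by (cases \<omega>) (auto simp: Cons_in_paths_between_iff split: if_splits)
qed

lemma paths_between_alt:
  "\<omega> \<in> paths_between g t x z \<longleftrightarrow>
     \<omega> \<noteq> [] \<and> hd \<omega> = x \<and> last \<omega> = z \<and> set (butlast \<omega>) \<inter> {g, t} = {}"
proof -
  have "(\<forall>k<length \<omega> - 1. \<omega> ! k \<notin> {t, g}) \<longleftrightarrow> (\<forall>y\<in>set (butlast \<omega>). y \<notin> {t, g})"
    by (auto simp: all_set_conv_all_nth nth_butlast)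
  then show ?thesis
    unfolding paths_between_def by blast
qed

lemma paths_between_prefix:
  "xs @ y # ys \<in> paths_between g t x z \<Longrightarrow> xs @ [y] \<in> paths_between g t x y"
  by (auto simp: paths_between_alt butlast_append hd_append split: if_splits)

text \<open>Turns comparisons with \<open>exit_time\<close> into statements about single positions.
  The empty set, with infimum \<infinity>, is included.\<close>

lemma less_Inf_enat_iff: "enat i < Inf {enat j | j. P j} \<longleftrightarrow> (\<forall>j\<le>i. \<not> P j)"
proof
  assume i: "enat i < Inf {enat j | j. P j}"
  show "\<forall>j\<le>i. \<not> P j"
  proof (intro allI impI notI)
    fix j assume "j \<le> i" "P j"
    then have "Inf {enat j | j. P j} \<le> enat j"
      by (intro Inf_lower) auto
    with i have "enat i < enat j"
      by (rule less_le_trans)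
    with \<open>j \<le> i\<close> show False by simp
  qed
next
  assume "\<forall>j\<le>i. \<not> P j"
  then have "enat (Suc i) \<le> Inf {enat j | j. P j}"
    by (intro Inf_greatest) (auto simp: Suc_le_eq not_le[symmetric])
  then show "enat i < Inf {enat j | j. P j}"
    by (rule less_le_trans[rotated]) simp
qed

lemma path_dist_le:
  assumes "\<omega> \<in> paths_between g t x z" "is_Theta (\<lambda>\<epsilon>. path_prob (K \<epsilon>) \<omega>) (\<lambda>\<epsilon>. \<epsilon> ^ r)"
  shows "path_dist K g t x z \<le> enat r"
  unfolding path_dist_def using assms by (intro Inf_lower) blast

text \<open>A finite infimum comes from a nonempty set, and a nonempty set of extended naturals
  contains its least element.\<close>

lemma path_dist_attained:
  assumes "path_dist K g t x z = enat n"
  obtains \<omega> where "\<omega> \<in> paths_between g t x z" "is_Theta (\<lambda>\<epsilon>. path_prob (K \<epsilon>) \<omega>) (\<lambda>\<epsilon>. \<epsilon> ^ n)"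
proof -
  let ?R = "{enat r | r. \<exists>\<omega>\<in>paths_between g t x z. is_Theta (\<lambda>\<epsilon>. path_prob (K \<epsilon>) \<omega>) (\<lambda>\<epsilon>. \<epsilon> ^ r)}"
  have "?R \<noteq> {}"
  proof
    assume empty: "?R = {}"
    have "path_dist K g t x z = \<infinity>"
      unfolding path_dist_def empty by (simp add: top_enat_def)
    with assms show False by simp
  qed
  then obtain y where "y \<in> ?R"
    by blast
  then have "(LEAST y. y \<in> ?R) \<in> ?R"
    by (rule LeastI)
  then have "Inf ?R \<in> ?R"
    unfolding Inf_enat_def using \<open>?R \<noteq> {}\<close> by (simp only: if_False)
  then show ?thesis
    using assms that unfolding path_dist_def by auto
qed

text \<open>On \<open>N\<close> the bound is a hypothesis; it has to be superharmonic only elsewhere. This allows weights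
  \<open>W\<close> that stop being Markovian once a path enters \<open>N\<close>, as those of \<open>\<Q>\<close> do on leaving \<open>\<Lambda>\<close>.\<close>

lemma sum_paths_le_potential:
  fixes W :: "'a list \<Rightarrow> real" and h :: "'a \<Rightarrow> real"
  assumes stopped: "\<And>x A. x \<in> N \<Longrightarrow> finite A \<Longrightarrow> A \<subseteq> (\<Union>z\<in>B. paths_between g t x z)
      \<Longrightarrow> sum W A \<le> h x"
    and N: "{g, t} \<subseteq> N" "B \<subseteq> N"
    and step: "\<And>x l. x \<notin> N \<Longrightarrow> l \<noteq> [] \<Longrightarrow> W (x # l) = c x (hd l) * W l"
    and c_nonneg: "\<And>x z. x \<notin> N \<Longrightarrow> 0 \<le> c x z"
    and superharmonic: "\<And>x Z. x \<notin> N \<Longrightarrow> finite Z \<Longrightarrow> (\<Sum>z\<in>Z. c x z * h z) \<le> h x"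
    and A: "finite A" "A \<subseteq> (\<Union>z\<in>B. paths_between g t x z)"
  shows "sum W A \<le> h x"
proof -
  \<comment> \<open>The induction is on a bound \<open>n\<close> for the lengths. Start state and
    set of paths vary, because removing the first state turns \<open>A\<close> into families of
    tails with different heads.\<close>
  have "sum W A \<le> h x"
    if "finite A" "A \<subseteq> (\<Union>z\<in>B. paths_between g t x z)" "\<forall>\<omega>\<in>A. length \<omega> \<le> n" for n x A
    using that
  proof (induction n arbitrary: x A)
    case 0
    then have "A = {}"
      by auto
    \<comment> \<open>The empty instances of the two hypotheses say
      \<open>0 \<le> h x\<close>.\<close>
    then show ?case
      using stopped[of x "{}"] superharmonic[of x "{}"] by (cases "x \<in> N") auto
  next
    case (Suc n)
    show ?case
    proof (cases "x \<in> N")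
      case True
      with Suc.prems show ?thesis by (intro stopped) auto
    next
      case False
      have A_shape: "\<exists>l. \<omega> = x # l \<and> l \<noteq> [] \<and> l \<in> (\<Union>z\<in>B. paths_between g t (hd l) z)"
        if "\<omega> \<in> A" for \<omega>
      proof -
        from that Suc.prems obtain z where z: "z \<in> B" "\<omega> \<in> paths_between g t x z" by auto
        then show ?thesis
          using False N by (cases \<omega>) (auto simp: Cons_in_paths_between_iff split: if_splits)
      qed
      define A' where "A' = tl ` A"
      have A_eq: "A = (#) x ` A'"
        unfolding A'_def image_image using A_shape by (force simp: image_iff)
      have fin: "finite A'"
        using Suc.prems by (simp add: A'_def)
      have A'D: "l \<noteq> []" "l \<in> (\<Union>z\<in>B. paths_between g t (hd l) z)" "length l \<le> n"
        if "l \<in> A'" for l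
        using that A_shape[of "x # l"] Suc.prems(3) by (auto simp: A_eq)
      have "sum W A = (\<Sum>l\<in>A'. W (x # l))"
        unfolding A_eq by (subst sum.reindex) (auto simp: inj_on_def)
      also have "\<dots> = (\<Sum>l\<in>A'. c x (hd l) * W l)"
        using False A'D by (intro sum.cong step) auto
      \<comment> \<open>Tails are grouped by their first state, so that the induction hypothesis
        applies to each group.\<close>
      also have "\<dots> = (\<Sum>z\<in>hd ` A'. \<Sum>l\<in>{l\<in>A'. hd l = z}. c x (hd l) * W l)"
        using fin by (rule sum.image_gen)
      also have "\<dots> = (\<Sum>z\<in>hd ` A'. c x z * (\<Sum>l\<in>{l\<in>A'. hd l = z}. W l))"
        by (simp add: sum_distrib_left)
      also have "\<dots> \<le> (\<Sum>z\<in>hd ` A'. c x z * h z)"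
      proof (intro sum_mono mult_left_mono Suc.IH c_nonneg False)
        fix z
        show "{l \<in> A'. hd l = z} \<subseteq> (\<Union>y\<in>B. paths_between g t z y)"
          using A'D(2) by blast
        show "finite {l \<in> A'. hd l = z}" "\<forall>l\<in>{l \<in> A'. hd l = z}. length l \<le> n"
          using fin A'D(3) by auto
      qed
      also have "\<dots> \<le> h x"
        using False fin by (intro superharmonic) auto
      finally show ?thesis .
    qed
  qed
  from this[of A x "Max (length ` A)"] A show ?thesis by simp
qed

text \<open>Stopped paths are mutually exclusive events. Formally, the constant potential 1 is
  superharmonic, since each row of the kernel has mass at most 1.\<close>

lemma sum_path_prob_le_1:
  assumes A: "finite A" "A \<subseteq> (\<Union>z\<in>{g, t}. paths_between g t x z)"
  shows "sum (path_prob M) A \<le> 1"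
proof -
  have absorbed: "sum (path_prob M) A' \<le> 1"
    if "y \<in> {g, t}" "A' \<subseteq> (\<Union>z\<in>{g, t}. paths_between g t y z)" for y A'
  proof -
    have "A' \<subseteq> {[y]}"
      using that(2) paths_between_absorbed[OF that(1)] by (rule subset_trans)
    then show ?thesis
      by (auto simp: subset_singleton_iff)
  qed
  have sum: "(\<Sum>z\<in>Z. pmf (M y) z * 1) \<le> 1" if "finite Z" for y Z
    using that by (simp add: sum_pmf_le_1)
  show ?thesis
    using sum_paths_le_potential[where N = "{g, t}" and B = "{g, t}" and h = "\<lambda>_. 1"
      and c = "\<lambda>x. pmf (M x)" and W = "path_prob M" and A = A,
      OF absorbed subset_refl subset_refl path_prob_Cons pmf_nonneg sum A] .
qed

section \<open>Dominant paths\<close>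

text \<open>Kept general because both the original and the modified kernel are instances.\<close>

locale polynomial_kernel =
  fixes K :: "real \<Rightarrow> 'a \<Rightarrow> 'a pmf" and e0 :: real
  assumes e0: "e0 > 0"
    and transitions: "\<And>x z.
          (\<forall>\<epsilon>. 0 < \<epsilon> \<and> \<epsilon> < e0 \<longrightarrow> pmf (K \<epsilon> x) z = 0) \<or>
          ((\<forall>\<epsilon>. 0 < \<epsilon> \<and> \<epsilon> < e0 \<longrightarrow> pmf (K \<epsilon> x) z > 0) \<and>
           (\<exists>r::nat. is_Theta (\<lambda>\<epsilon>. pmf (K \<epsilon> x) z) (\<lambda>\<epsilon>. \<epsilon> ^ r)))"
begin

abbreviation step_order :: "'a \<Rightarrow> 'a \<Rightarrow> nat \<Rightarrow> bool" where
  "step_order x z r \<equiv> is_Theta (\<lambda>\<epsilon>. pmf (K \<epsilon> x) z) (\<lambda>\<epsilon>. \<epsilon> ^ r)"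

abbreviation path_order :: "'a list \<Rightarrow> nat \<Rightarrow> bool" where
  "path_order \<omega> r \<equiv> is_Theta (\<lambda>\<epsilon>. path_prob (K \<epsilon>) \<omega>) (\<lambda>\<epsilon>. \<epsilon> ^ r)"

lemma eventually_small: "\<forall>\<^sub>F \<epsilon> in at_right 0. 0 < \<epsilon> \<and> \<epsilon> < e0"
  using e0 by (auto simp: eventually_at_right_field)

text \<open>An order forces positivity at some small parameter, which rules out the first
  alternative of \<open>transitions\<close>; the second one gives positivity on the whole
  interval.\<close>

lemma step_order_pos:
  assumes "step_order x z r" "0 < \<epsilon>" "\<epsilon> < e0"
  shows "pmf (K \<epsilon> x) z > 0"
proof -
  have "\<forall>\<^sub>F \<epsilon> in at_right 0. 0 < pmf (K \<epsilon> x) z \<and> 0 < \<epsilon> \<and> \<epsilon> < e0"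
    using is_Theta_power_eventually_pos[OF assms(1)] eventually_small by (rule eventually_conj)
  from eventually_happens'[OF trivial_limit_at_right_real this]
  obtain \<delta> where "0 < pmf (K \<delta> x) z" "0 < \<delta>" "\<delta> < e0"
    by blast
  then have "\<not> (\<forall>\<epsilon>. 0 < \<epsilon> \<and> \<epsilon> < e0 \<longrightarrow> pmf (K \<epsilon> x) z = 0)"
    by auto
  with transitions[of x z] assms(2,3) show ?thesis
    by simp
qed

lemma step_order_exists:
  assumes "0 < \<epsilon>" "\<epsilon> < e0" "pmf (K \<epsilon> x) z > 0"
  shows "\<exists>r. step_order x z r"
proof -
  from assms have "\<not> (\<forall>\<epsilon>. 0 < \<epsilon> \<and> \<epsilon> < e0 \<longrightarrow> pmf (K \<epsilon> x) z = 0)"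
    by auto
  with transitions[of x z] show ?thesis
    by simp
qed

lemma path_order_singleton: "path_order [x] r \<longleftrightarrow> r = 0"
proof -
  have "path_order [x] 0"
    by (auto simp: is_Theta_def intro!: exI[of _ 1])
  then show ?thesis
    using is_Theta_power_unique by blast
qed

lemma path_order_ConsI:
  "l \<noteq> [] \<Longrightarrow> step_order x (hd l) r \<Longrightarrow> path_order l m \<Longrightarrow> path_order (x # l) (r + m)"
  by (simp add: path_prob_Cons is_Theta_power_mult)

lemma path_order_exists:
  assumes "\<omega> \<noteq> []" "0 < \<epsilon>" "\<epsilon> < e0" "path_prob (K \<epsilon>) \<omega> > 0"
  shows "\<exists>r. path_order \<omega> r"
  using assms
proof (induction \<omega>)
  case (Cons x l)
  show ?case
  proof (cases "l = []")
    case True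
    then show ?thesis using path_order_singleton by auto
  next
    case False
    then have "pmf (K \<epsilon> x) (hd l) * path_prob (K \<epsilon>) l > 0"
      using Cons.prems by (simp add: path_prob_Cons)
    then have "pmf (K \<epsilon> x) (hd l) > 0" "path_prob (K \<epsilon>) l > 0"
      using pmf_nonneg[of "K \<epsilon> x" "hd l"] path_prob_nonneg[of "K \<epsilon>" l]
      by (auto simp: zero_less_mult_iff)
    then obtain r m where "step_order x (hd l) r" "path_order l m"
      using Cons.IH step_order_exists Cons.prems False by metis
    from path_order_ConsI[OF False this] show ?thesis ..
  qed
qed auto

text \<open>From left to right: the path probability is positive at some small \<epsilon>, so both
  factors are positive there and have orders; uniqueness of the order identifies their sum.\<close>

lemma path_order_Cons:
  assumes "l \<noteq> []"
  shows "path_order (x # l) n \<longleftrightarrow> (\<exists>r m. step_order x (hd l) r \<and> path_order l m \<and> n = r + m)"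
proof
  assume n: "path_order (x # l) n"
  have "\<forall>\<^sub>F \<epsilon> in at_right 0. 0 < path_prob (K \<epsilon>) (x # l) \<and> 0 < \<epsilon> \<and> \<epsilon> < e0"
    using is_Theta_power_eventually_pos[OF n] eventually_small by (rule eventually_conj)
  from eventually_happens'[OF trivial_limit_at_right_real this]
  obtain \<epsilon> where \<epsilon>: "0 < path_prob (K \<epsilon>) (x # l)" "0 < \<epsilon>" "\<epsilon> < e0"
    by blast
  then have "pmf (K \<epsilon> x) (hd l) > 0" "path_prob (K \<epsilon>) l > 0"
    using pmf_nonneg[of "K \<epsilon> x" "hd l"] path_prob_nonneg[of "K \<epsilon>" l] assms
    by (auto simp: zero_less_mult_iff path_prob_Cons)
  then obtain r m where rm: "step_order x (hd l) r" "path_order l m"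
    using path_order_exists step_order_exists \<epsilon> assms by metis
  from path_order_ConsI[OF assms this] have "path_order (x # l) (r + m)" .
  with n rm show "\<exists>r m. step_order x (hd l) r \<and> path_order l m \<and> n = r + m"
    using is_Theta_power_unique by blast
next
  assume "\<exists>r m. step_order x (hd l) r \<and> path_order l m \<and> n = r + m"
  with assms show "path_order (x # l) n"
    using path_order_ConsI by blast
qed

text \<open>The state \<open>y\<close> ends the first piece and starts the second, so every
  transition is counted exactly once.\<close>

lemma path_order_split:
  "path_order (xs @ y # ys) r \<Longrightarrow> \<exists>a b. path_order (xs @ [y]) a \<and> path_order (y # ys) b \<and> r = a + b"
proof (induction xs arbitrary: r)
  case Nil
  have "path_order ([] @ [y]) 0"
    by (simp only: append_Nil path_order_singleton)
  with Nil show ?case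
    by (metis add_0 append_Nil)
next
  case (Cons x xs)
  have ne: "xs @ y # ys \<noteq> []" "xs @ [y] \<noteq> []"
    by auto
  from Cons.prems obtain c m where c: "step_order x (hd (xs @ y # ys)) c"
    and m: "path_order (xs @ y # ys) m" "r = c + m"
    unfolding append_Cons path_order_Cons[OF ne(1)] by blast
  from Cons.IH[OF m(1)] obtain a b where ab: "path_order (xs @ [y]) a" "path_order (y # ys) b" "m = a + b"
    by blast
  have "hd (xs @ y # ys) = hd (xs @ [y])"
    by (cases xs) auto
  with c have "path_order (x # xs @ [y]) (c + a)"
    by (intro path_order_ConsI ne(2) ab(1)) simp
  with ab m show ?case
    by (intro exI[of _ "c + a"] exI[of _ b]) simp
qed

end

text \<open>\<open>S\<close> is the finite part of the state space that matters, later
  \<open>\<Lambda> \<union> \<Gamma>\<close>; closedness keeps the sums over successors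
  finite.\<close>

locale rare_event_chain = polynomial_kernel K e0
  for K :: "real \<Rightarrow> 'a \<Rightarrow> 'a pmf" and e0 :: real +
  fixes g t :: 'a and S :: "'a set"
  assumes finite_S: "finite S"
    and closed_S: "\<And>\<epsilon> x z. x \<in> S \<Longrightarrow> x \<notin> {g, t} \<Longrightarrow> 0 < \<epsilon> \<Longrightarrow> \<epsilon> < e0 \<Longrightarrow>
          pmf (K \<epsilon> x) z > 0 \<Longrightarrow> z \<in> S"
    and no_cycle: "\<And>\<omega>. length \<omega> \<ge> 2 \<Longrightarrow> last \<omega> = hd \<omega> \<Longrightarrow> set \<omega> \<inter> {g, t} = {} \<Longrightarrow>
          \<not> is_Theta (\<lambda>\<epsilon>. path_prob (K \<epsilon>) \<omega>) (\<lambda>\<epsilon>. \<epsilon> ^ 0)"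
begin

section \<open>Optimal paths to the goal and the graph of dominant steps\<close>

abbreviation goal_dist :: "'a \<Rightarrow> enat" where
  "goal_dist x \<equiv> path_dist K g t x g"

definition dominant :: "'a \<Rightarrow> 'a list set" where
  "dominant x = {\<omega> \<in> paths_between g t x g. \<exists>r. goal_dist x = enat r \<and> path_order \<omega> r}"

definition val :: "real \<Rightarrow> 'a \<Rightarrow> real" where
  "val \<epsilon> x = (\<Sum>\<^sub>\<infinity>\<omega>\<in>dominant x. path_prob (K \<epsilon>) \<omega>)"

text \<open>Edges point from the successor \<open>z\<close> to the predecessor \<open>x\<close>, so
  that well-founded induction starts at the goal. The equation says that the step to
  \<open>z\<close> attains the minimum in the shortest-path recursion.\<close>

definition dom_edges :: "('a \<times> 'a) set" where
  "dom_edges = {(z, x). x \<in> S \<and> z \<in> S \<and> x \<notin> {g, t} \<and>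
     (\<exists>r m. step_order x z r \<and> goal_dist z = enat m \<and> goal_dist x = enat (r + m))}"

text \<open>A height function on the dominant graph: it counts the states reachable from
  \<open>x\<close> by one or more dominant steps.\<close>

definition rank :: "'a \<Rightarrow> nat" where
  "rank x = card {y. (y, x) \<in> dom_edges\<^sup>+}"

lemma goal_dist_step:
  assumes "x \<notin> {g, t}" "step_order x z r" "goal_dist z = enat m"
  shows "goal_dist x \<le> enat (r + m)"
proof -
  from assms(3) obtain \<omega> where \<omega>: "\<omega> \<in> paths_between g t z g" "path_order \<omega> m"
    by (rule path_dist_attained)
  then have "\<omega> \<noteq> []" "hd \<omega> = z"
    by (auto simp: paths_between_def)
  with \<omega> assms show ?thesis
    by (intro path_dist_le[of "x # \<omega>"]) (auto simp: Cons_in_paths_between_iff path_order_Cons)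
qed

lemma path_order_imp_goal_dist:
  assumes "\<omega> \<in> paths_between g t x g" "path_order \<omega> r"
  obtains n where "goal_dist x = enat n" "n \<le> r"
  using path_dist_le[OF assms] by (cases "goal_dist x") auto

lemma dominant_goal: "dominant g = {[g]}" "goal_dist g = 0"
proof -
  have mem: "[g] \<in> paths_between g t g g"
    by (simp add: Cons_in_paths_between_iff)
  have order: "path_order [g] 0"
    by (simp only: path_order_singleton)
  from path_dist_le[OF mem this] show dist: "goal_dist g = 0"
    by (simp flip: zero_enat_def)
  have "\<omega> = [g]" if "\<omega> \<in> dominant g" for \<omega>
    using that paths_between_absorbed[of g g t "{g}"] by (auto simp: dominant_def)
  moreover have "[g] \<in> dominant g"
    unfolding dominant_def dist zero_enat_def using mem order by blast
  ultimately show "dominant g = {[g]}"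
    by blast
qed

text \<open>Principle of optimality: the tail of a dominant path is dominant, and prefixing a
  dominant step preserves dominance.\<close>

lemma dominant_Cons:
  assumes x: "x \<in> S" "x \<notin> {g, t}"
  shows "dominant x = (\<Union>z\<in>{z. (z, x) \<in> dom_edges}. (#) x ` dominant z)"
proof (intro equalityI subsetI)
  fix \<omega> assume \<omega>: "\<omega> \<in> dominant x"
  then obtain l where l: "\<omega> = x # l" "l \<noteq> []" "l \<in> paths_between g t (hd l) g"
    using x by (cases \<omega>) (auto simp: dominant_def Cons_in_paths_between_iff split: if_splits)
  from \<omega> l obtain r m where rm: "goal_dist x = enat (r + m)" "step_order x (hd l) r" "path_order l m"
    by (auto simp: dominant_def path_order_Cons)
  from l(3) rm(3) obtain m' where m': "goal_dist (hd l) = enat m'" "m' \<le> m"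
    by (rule path_order_imp_goal_dist)
  \<comment> \<open>A strictly better tail would put the distance of \<open>x\<close> below
    \<open>r + m\<close>.\<close>
  with goal_dist_step[OF x(2) rm(2) m'(1)] rm(1) have "m' = m"
    by simp
  moreover obtain \<epsilon> where "0 < \<epsilon>" "\<epsilon> < e0"
    using e0 dense by blast
  then have "hd l \<in> S"
    using closed_S x step_order_pos[OF rm(2)] by blast
  ultimately have "(hd l, x) \<in> dom_edges" "l \<in> dominant (hd l)"
    using x rm m' l by (auto simp: dom_edges_def dominant_def)
  with l(1) show "\<omega> \<in> (\<Union>z\<in>{z. (z, x) \<in> dom_edges}. (#) x ` dominant z)"
    by blast
next
  fix \<omega> assume "\<omega> \<in> (\<Union>z\<in>{z. (z, x) \<in> dom_edges}. (#) x ` dominant z)"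
  then obtain z l where zl: "(z, x) \<in> dom_edges" "l \<in> dominant z" "\<omega> = x # l"
    by blast
  then have "l \<noteq> []" "hd l = z"
    by (auto simp: dominant_def paths_between_def)
  moreover from zl obtain r m where "step_order x z r" "goal_dist x = enat (r + m)" "path_order l m"
    by (auto simp: dom_edges_def dominant_def)
  ultimately have "path_order \<omega> (r + m)"
    using path_order_ConsI[of l x r m] zl(3) by simp
  with \<open>l \<noteq> []\<close> \<open>hd l = z\<close> \<open>goal_dist x = enat (r + m)\<close> zl x show "\<omega> \<in> dominant x"
    by (auto simp: dominant_def Cons_in_paths_between_iff)
qed

lemma finite_dom_edges: "finite dom_edges"
  by (rule finite_subset[of _ "S \<times> S"]) (auto simp: dom_edges_def finite_S)

text \<open>Along dominant steps the order of the path telescopes to the drop in goal distance. The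
  list runs from \<open>x\<close> to \<open>z\<close>, against the edges, and only its last state
  may lie in \<open>{g, t}\<close>.\<close>

lemma dom_edges_path:
  assumes "(z, x) \<in> dom_edges\<^sup>+"
  shows "\<exists>\<omega> r m. length \<omega> \<ge> 2 \<and> hd \<omega> = x \<and> last \<omega> = z \<and> set (butlast \<omega>) \<inter> {g, t} = {} \<and>
    path_order \<omega> r \<and> goal_dist z = enat m \<and> goal_dist x = enat (r + m)"
  using assms
proof (induction rule: trancl_induct)
  case (base x)
  then obtain r m where "x \<notin> {g, t}" "step_order x z r" "goal_dist z = enat m"
    "goal_dist x = enat (r + m)"
    by (auto simp: dom_edges_def)
  then show ?case
    by (intro exI[of _ "[x, z]"] exI[of _ r] exI[of _ m])
       (auto simp: path_prob_Cons)
next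
  case (step y x)
  from step.hyps(2) obtain a b where ab: "x \<notin> {g, t}" "step_order x y a" "goal_dist y = enat b"
    "goal_dist x = enat (a + b)"
    by (auto simp: dom_edges_def)
  from step.IH obtain \<omega> r m where \<omega>: "length \<omega> \<ge> 2" "hd \<omega> = y" "last \<omega> = z"
    "set (butlast \<omega>) \<inter> {g, t} = {}" "path_order \<omega> r" "goal_dist z = enat m"
    "goal_dist y = enat (r + m)"
    by blast
  moreover from \<omega>(1) have "\<omega> \<noteq> []"
    by auto
  moreover from this \<omega>(2,5) ab(2) have "path_order (x # \<omega>) (a + r)"
    by (simp add: path_order_ConsI)
  ultimately show ?case
    using ab by (intro exI[of _ "x # \<omega>"] exI[of _ "a + r"] exI[of _ m]) auto
qed

text \<open>Around a cycle the distance drops by 0, so the path would be a high-probability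
  cycle.\<close>

lemma acyclic_dom_edges: "acyclic dom_edges"
proof (rule acyclicI, safe)
  fix x assume "(x, x) \<in> dom_edges\<^sup>+"
  from dom_edges_path[OF this] obtain \<omega> r m where \<omega>: "length \<omega> \<ge> 2" "hd \<omega> = x" "last \<omega> = x"
    "set (butlast \<omega>) \<inter> {g, t} = {}" "path_order \<omega> r" "goal_dist x = enat m"
    "goal_dist x = enat (r + m)"
    by blast
  then have "r = 0"
    by simp
  moreover from \<omega> obtain a b l where abl: "\<omega> = a # b # l"
    by (cases \<omega>; cases "tl \<omega>") auto
  \<comment> \<open>The last state equals the first, which lies in \<open>butlast\<close>; thus the
    whole cycle avoids \<open>g\<close> and \<open>t\<close>.\<close>
  have "set \<omega> = insert (last \<omega>) (set (butlast \<omega>))"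
    using abl by (metis append_butlast_last_id list.distinct(1) list.simps(15) rotate1.simps(2) set_rotate1)
  moreover have "x \<in> set (butlast \<omega>)"
    using abl \<omega> by auto
  ultimately show False
    using no_cycle[of \<omega>] \<omega> by auto
qed

lemma wf_dom_edges: "wf dom_edges"
  by (rule finite_acyclic_wf[OF finite_dom_edges acyclic_dom_edges])

lemma rank_less:
  assumes "(z, x) \<in> dom_edges"
  shows "rank z < rank x"
  unfolding rank_def
proof (rule psubset_card_mono)
  show "finite {y. (y, x) \<in> dom_edges\<^sup>+}"
    by (rule finite_subset[of _ "fst ` dom_edges\<^sup>+"])
       (force simp: finite_dom_edges)+
  have "z \<notin> {y. (y, z) \<in> dom_edges\<^sup>+}" "z \<in> {y. (y, x) \<in> dom_edges\<^sup>+}"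
    using assms acyclic_dom_edges by (auto simp: acyclic_def)
  then show "{y. (y, z) \<in> dom_edges\<^sup>+} \<subset> {y. (y, x) \<in> dom_edges\<^sup>+}"
    using assms by (auto intro: trancl.trancl_into_trancl)
qed

text \<open>Each state has finitely many dominant successors and the graph is well-founded, so the
  tree of dominant paths is finite. This turns \<open>val\<close> into a finite sum.\<close>

lemma finite_dominant: "x \<in> S \<Longrightarrow> finite (dominant x)"
proof (induction x rule: wf_induct_rule[OF wf_dom_edges])
  case (1 x)
  consider "x = g" | "x = t" "x \<noteq> g" | "x \<notin> {g, t}" by auto
  then show ?case
  proof cases
    case 2
    then have "dominant x \<subseteq> {[t]}"
      using paths_between_absorbed[of t g t "{g}"] by (auto simp: dominant_def)
    then show ?thesis by (rule finite_subset) simp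
  next
    case 3
    have "{z. (z, x) \<in> dom_edges} \<subseteq> S"
      by (auto simp: dom_edges_def)
    then show ?thesis
      using 1 3 finite_subset[OF _ finite_S] by (auto simp: dominant_Cons dom_edges_def)
  qed (simp add: dominant_goal)
qed

lemma val_eq_sum: "x \<in> S \<Longrightarrow> val \<epsilon> x = (\<Sum>\<omega>\<in>dominant x. path_prob (K \<epsilon>) \<omega>)"
  by (simp add: val_def finite_dominant)

lemma val_nonneg: "val \<epsilon> x \<ge> 0"
  by (simp add: val_def infsum_nonneg path_prob_nonneg)

lemma val_goal: "val \<epsilon> g = 1"
  by (simp add: val_def dominant_goal)

lemma val_infinite_dist: "goal_dist x = \<infinity> \<Longrightarrow> val \<epsilon> x = 0"
  by (simp add: val_def dominant_def)

lemma val_Theta: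
  assumes "x \<in> S" "goal_dist x = enat n"
  shows "is_Theta (\<lambda>\<epsilon>. val \<epsilon> x) (\<lambda>\<epsilon>. \<epsilon> ^ n)"
proof -
  from path_dist_attained[OF assms(2)] assms(2) have "dominant x \<noteq> {}"
    unfolding dominant_def by blast
  moreover have "path_order \<omega> n" if "\<omega> \<in> dominant x" for \<omega>
    using that assms(2) by (auto simp: dominant_def)
  ultimately show ?thesis
    unfolding val_eq_sum[OF assms(1)]
    by (intro is_Theta_power_sum finite_dominant assms(1))
qed

lemma val_rec:
  assumes x: "x \<in> S" "x \<notin> {g, t}"
  shows "val \<epsilon> x = (\<Sum>z\<in>{z. (z, x) \<in> dom_edges}. pmf (K \<epsilon> x) z * val \<epsilon> z)"
proof -
  let ?D = "{z. (z, x) \<in> dom_edges}"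
  have D: "z \<in> S" if "z \<in> ?D" for z
    using that by (auto simp: dom_edges_def)
  have hd: "l \<noteq> []" "hd l = z" if "l \<in> dominant z" for l z
    using that by (auto simp: dominant_def paths_between_def)
  have fin: "finite ?D"
    using finite_S D by (metis finite_subset subsetI)
  have "val \<epsilon> x = (\<Sum>\<omega>\<in>(\<Union>z\<in>?D. (#) x ` dominant z). path_prob (K \<epsilon>) \<omega>)"
    by (simp only: val_eq_sum[OF x(1)] dominant_Cons[OF x])
  \<comment> \<open>The union is disjoint, as the second state of a path determines
    \<open>z\<close>.\<close>
  also have "\<dots> = (\<Sum>z\<in>?D. \<Sum>\<omega>\<in>(#) x ` dominant z. path_prob (K \<epsilon>) \<omega>)"
    using fin D hd by (intro sum.UNION_disjoint) (auto simp: finite_dominant, metis)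
  also have "\<dots> = (\<Sum>z\<in>?D. \<Sum>l\<in>dominant z. path_prob (K \<epsilon>) (x # l))"
    by (simp add: sum.reindex inj_on_def)
  also have "\<dots> = (\<Sum>z\<in>?D. \<Sum>l\<in>dominant z. pmf (K \<epsilon> x) z * path_prob (K \<epsilon>) l)"
    using hd by (intro sum.cong refl) (auto simp: path_prob_Cons)
  also have "\<dots> = (\<Sum>z\<in>?D. pmf (K \<epsilon> x) z * val \<epsilon> z)"
    using D by (intro sum.cong) (auto simp: val_eq_sum sum_distrib_left)
  finally show ?thesis .
qed

text \<open>The normalising denominator of an importance sampling step. Unlike the recursion for
  \<open>val\<close>, it includes the non-dominant successors.\<close>

definition succ_val :: "real \<Rightarrow> 'a \<Rightarrow> real" where
  "succ_val \<epsilon> x = (\<Sum>\<^sub>\<infinity>z. pmf (K \<epsilon> x) z * val \<epsilon> z)"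

lemma succ_val_eq_sum:
  assumes "x \<in> S" "x \<notin> {g, t}" "0 < \<epsilon>" "\<epsilon> < e0"
  shows "succ_val \<epsilon> x = (\<Sum>z\<in>S. pmf (K \<epsilon> x) z * val \<epsilon> z)"
proof -
  have "pmf (K \<epsilon> x) z = 0" if "z \<notin> S" for z
    using closed_S[OF assms, of z] that pmf_nonneg[of "K \<epsilon> x" z] by linarith
  then have "succ_val \<epsilon> x = (\<Sum>\<^sub>\<infinity>z\<in>S. pmf (K \<epsilon> x) z * val \<epsilon> z)"
    unfolding succ_val_def by (intro infsum_cong_neutral) auto
  then show ?thesis
    by (simp add: finite_S)
qed

text \<open>A possible step to a state of finite distance that is not dominant has
  \<open>n < r + m\<close>, hence loses at least one power of \<epsilon>. In the other cases the
  transition probability or \<open>val \<epsilon> z\<close> is 0.\<close>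

lemma non_dominant_negligible:
  assumes x: "x \<in> S" "x \<notin> {g, t}" "goal_dist x = enat n" and z: "z \<in> S" "(z, x) \<notin> dom_edges"
  shows "((\<lambda>\<epsilon>. pmf (K \<epsilon> x) z * val \<epsilon> z / val \<epsilon> x) \<longlongrightarrow> 0) (at_right 0)"
proof (cases "\<exists>r. step_order x z r")
  case False
  have "\<forall>\<^sub>F \<epsilon> in at_right 0. 0 = pmf (K \<epsilon> x) z * val \<epsilon> z / val \<epsilon> x"
    using eventually_small
  proof eventually_elim
    case (elim \<epsilon>)
    with False have "pmf (K \<epsilon> x) z = 0"
      using transitions[of x z] by blast
    then show ?case by simp
  qed
  then show ?thesis
    by (rule Lim_transform_eventually[OF tendsto_const])
next
  case True
  then obtain r where r: "step_order x z r" ..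
  show ?thesis
  proof (cases "goal_dist z")
    case infinity
    then show ?thesis by (simp add: val_infinite_dist)
  next
    case (enat m)
    have "n \<le> r + m" "n \<noteq> r + m"
      using goal_dist_step[OF x(2) r enat] x z r enat by (auto simp: dom_edges_def)
    then have "n < r + m" by simp
    with is_Theta_power_mult[OF r val_Theta[OF z(1) enat]] val_Theta[OF x(1,3)] show ?thesis
      by (rule is_Theta_power_divide_tendsto_0)
  qed
qed

text \<open>Under the change of measure, a dominant edge lowers the potential \<open>1 + \<eta> * rank\<close> by at least
  \<open>\<eta>\<close>, and all other edges have vanishing probability. This margin absorbs the excess of
  \<open>succ_val / val\<close> over 1 for small \<open>\<epsilon>\<close>.\<close>

lemma eventually_potential:
  fixes \<eta> :: real
  assumes x: "x \<in> S" "x \<notin> {g, t}" "goal_dist x = enat n" and \<eta>: "\<eta> > 0"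
  shows "\<forall>\<^sub>F \<epsilon> in at_right 0.
    succ_val \<epsilon> x / val \<epsilon> x * (\<Sum>z\<in>S. pmf (K \<epsilon> x) z * (val \<epsilon> z * (1 + \<eta> * rank z))) \<le>
    val \<epsilon> x * (1 + \<eta> * rank x)"
proof -
  define D where "D = {z. (z, x) \<in> dom_edges}"
  have D: "D \<subseteq> S"
    by (auto simp: D_def dom_edges_def)
  \<comment> \<open>The contribution of the non-dominant successors with weights \<open>h\<close>,
    relative to \<open>val \<epsilon> x\<close>.\<close>
  define R where "R h \<epsilon> = (\<Sum>z\<in>S - D. h z * (pmf (K \<epsilon> x) z * val \<epsilon> z / val \<epsilon> x))" for h \<epsilon>
  have R: "(R h \<longlongrightarrow> 0) (at_right 0)" for h
  proof -
    have "(R h \<longlongrightarrow> (\<Sum>z\<in>S - D. h z * 0)) (at_right 0)"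
      unfolding R_def using x
      by (intro tendsto_intros non_dominant_negligible) (auto simp: D_def)
    then show ?thesis by simp
  qed
  define k :: "'a \<Rightarrow> real" where "k z = 1 + \<eta> * rank z" for z
  \<comment> \<open>The limit \<open>k x - \<eta>\<close> lies strictly below \<open>k x\<close>;
    this gap leaves room for both vanishing errors.\<close>
  have "((\<lambda>\<epsilon>. (1 + R (\<lambda>_. 1) \<epsilon>) * (k x - \<eta> + R k \<epsilon>)) \<longlongrightarrow> (1 + 0) * (k x - \<eta> + 0)) (at_right 0)"
    by (intro tendsto_intros R)
  then have "\<forall>\<^sub>F \<epsilon> in at_right 0. (1 + R (\<lambda>_. 1) \<epsilon>) * (k x - \<eta> + R k \<epsilon>) < k x"
    using \<eta> by (intro order_tendstoD(2)) auto
  then show ?thesis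
    using is_Theta_power_eventually_pos[OF val_Theta[OF x(1,3)]] eventually_small
  proof eventually_elim
    case (elim \<epsilon>)
    have split: "(\<Sum>z\<in>S. h z * (pmf (K \<epsilon> x) z * val \<epsilon> z)) =
        (\<Sum>z\<in>D. h z * (pmf (K \<epsilon> x) z * val \<epsilon> z)) + val \<epsilon> x * R h \<epsilon>" for h
      unfolding R_def sum_distrib_left using elim
      by (subst sum.subset_diff[OF D finite_S]) (simp add: mult.left_commute)
    have succ: "succ_val \<epsilon> x = val \<epsilon> x * (1 + R (\<lambda>_. 1) \<epsilon>)"
      using split[of "\<lambda>_. 1"] x elim
      by (simp add: succ_val_eq_sum val_rec[of x] D_def distrib_left)
    have "(\<Sum>z\<in>D. k z * (pmf (K \<epsilon> x) z * val \<epsilon> z)) \<le>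
        (\<Sum>z\<in>D. (k x - \<eta>) * (pmf (K \<epsilon> x) z * val \<epsilon> z))"
    proof (intro sum_mono mult_right_mono mult_nonneg_nonneg val_nonneg pmf_nonneg)
      fix z assume "z \<in> D"
      then have "real (rank z) + 1 \<le> rank x"
        using rank_less[of z x] by (simp add: D_def)
      then have "\<eta> * (real (rank z) + 1) \<le> \<eta> * rank x"
        using \<eta> by (intro mult_left_mono) auto
      then show "k z \<le> k x - \<eta>"
        by (simp add: k_def algebra_simps)
    qed
    also have "\<dots> = (k x - \<eta>) * val \<epsilon> x"
      using x by (simp add: val_rec[of x] D_def sum_distrib_left)
    finally have "(\<Sum>z\<in>S. k z * (pmf (K \<epsilon> x) z * val \<epsilon> z)) \<le> val \<epsilon> x * (k x - \<eta> + R k \<epsilon>)"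
      unfolding split by (simp add: algebra_simps)
    moreover have "0 \<le> 1 + R (\<lambda>_. 1) \<epsilon>"
      unfolding R_def by (intro add_nonneg_nonneg sum_nonneg mult_nonneg_nonneg divide_nonneg_nonneg
          val_nonneg pmf_nonneg) auto
    ultimately have "(1 + R (\<lambda>_. 1) \<epsilon>) * (\<Sum>z\<in>S. k z * (pmf (K \<epsilon> x) z * val \<epsilon> z)) \<le>
        (1 + R (\<lambda>_. 1) \<epsilon>) * (val \<epsilon> x * (k x - \<eta> + R k \<epsilon>))"
      by (intro mult_left_mono)
    also have "\<dots> = val \<epsilon> x * ((1 + R (\<lambda>_. 1) \<epsilon>) * (k x - \<eta> + R k \<epsilon>))"
      by (simp add: mult.left_commute)
    also have "\<dots> \<le> val \<epsilon> x * k x"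
      using elim by (intro mult_left_mono) auto
    finally show ?case
      using elim by (simp add: succ k_def mult_ac)
  qed
qed

end

section \<open>The importance sampling measure\<close>

locale importance_sampling =
  fixes p :: "real \<Rightarrow> 'a \<Rightarrow> 'a pmf" and s g t :: 'a and \<epsilon>\<^sub>0 :: real
  assumes eps0: "\<epsilon>\<^sub>0 > 0"
    and transitions_p: "\<And>x z.
          (\<forall>\<epsilon>. 0 < \<epsilon> \<and> \<epsilon> < \<epsilon>\<^sub>0 \<longrightarrow> pmf (p \<epsilon> x) z = 0) \<or>
          ((\<forall>\<epsilon>. 0 < \<epsilon> \<and> \<epsilon> < \<epsilon>\<^sub>0 \<longrightarrow> pmf (p \<epsilon> x) z > 0) \<and>
           (\<exists>r::nat. is_Theta (\<lambda>\<epsilon>. pmf (p \<epsilon> x) z) (\<lambda>\<epsilon>. \<epsilon> ^ r)))"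
    and finite_Lambda: "finite (\<Lambda> p s g t)"
    and finite_Gamma: "finite (\<Gamma> p s g t)"
    and goal_reachable: "path_dist p g t s g < \<infinity>"
    and no_high_prob_cycle: "\<And>\<omega>. length \<omega> \<ge> 2 \<Longrightarrow> last \<omega> = hd \<omega> \<Longrightarrow>
          is_Theta (\<lambda>\<epsilon>. path_prob (p \<epsilon>) \<omega>) (\<lambda>\<epsilon>. \<epsilon> ^ 0) \<Longrightarrow>
          set \<omega> = {g} \<or> set \<omega> = {t}"
begin

section \<open>Comparison of the original and the modified chain\<close>

sublocale orig: polynomial_kernel p \<epsilon>\<^sub>0
  by unfold_locales (fact eps0, fact transitions_p)

abbreviation "L \<equiv> \<Lambda> p s g t"
abbreviation "G \<equiv> \<Gamma> p s g t"
abbreviation "p' \<equiv> pbar p s g t"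

text \<open>\<open>\<Gamma>\<close> asks for positivity at all small \<epsilon>; positivity at one
  admissible value suffices, because it provides an order.\<close>

lemma successor_of_Lambda:
  assumes "x \<in> L" "0 < \<epsilon>" "\<epsilon> < \<epsilon>\<^sub>0" "pmf (p \<epsilon> x) z > 0"
  shows "z \<in> L \<union> G"
proof (cases "z \<in> L")
  case False
  have "\<forall>\<^sub>F \<epsilon> in at_right 0. pmf (p \<epsilon> x) z > 0"
    using orig.step_order_exists[OF assms(2-4)] is_Theta_power_eventually_pos by blast
  with False assms(1) show ?thesis
    unfolding \<Gamma>_def by blast
qed simp

lemma pbar_Lambda: "x \<in> L \<Longrightarrow> p' \<epsilon> x = p \<epsilon> x"
  by (simp add: pbar_def \<Gamma>_def)

lemma pbar_Gamma: "x \<in> G \<Longrightarrow> p' \<epsilon> x = return_pmf g"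
  by (simp add: pbar_def)

lemma Lambda_Gamma_disjoint: "x \<in> L \<Longrightarrow> x \<notin> G"
  by (simp add: \<Gamma>_def)

lemma goal_in_Lambda: "g \<in> L"
  by (simp add: \<Lambda>_def)

text \<open>No transition of the path leaves its last state, so only \<open>butlast\<close> has to
  avoid \<open>\<Gamma>\<close>.\<close>

lemma path_prob_pbar:
  assumes "set (butlast \<omega>) \<inter> G = {}"
  shows "path_prob (p' \<epsilon>) \<omega> = path_prob (p \<epsilon>) \<omega>"
  unfolding path_prob_def
proof (intro prod.cong refl)
  fix i assume i: "i \<in> {..<length \<omega> - 1}"
  then have "butlast \<omega> ! i \<in> set (butlast \<omega>)"
    by (intro nth_mem) simp
  with i have "\<omega> ! i \<in> set (butlast \<omega>)"
    by (simp add: nth_butlast)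
  with assms show "pmf (p' \<epsilon> (\<omega> ! i)) (\<omega> ! Suc i) = pmf (p \<epsilon> (\<omega> ! i)) (\<omega> ! Suc i)"
    by (auto simp: pbar_def)
qed

lemma path_prob_pbar_Gamma:
  assumes "y \<in> set (butlast \<omega>)" "y \<in> G" "g \<notin> set \<omega>"
  shows "path_prob (p' \<epsilon>) \<omega> = 0"
proof -
  from assms(1) obtain i where i: "i < length \<omega> - 1" "\<omega> ! i = y"
    by (auto simp: in_set_conv_nth nth_butlast)
  then have "\<omega> ! Suc i \<noteq> g"
    using assms(3) by (metis Suc_lessI diff_Suc_1 less_diff_conv add.commute plus_1_eq_Suc nth_mem)
  with i assms(2) have "pmf (p' \<epsilon> (\<omega> ! i)) (\<omega> ! Suc i) = 0"
    by (auto simp: pbar_Gamma pmf_return)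
  with i(1) show ?thesis
    unfolding path_prob_def by (intro prod_zero) auto
qed

text \<open>From here on unqualified notions refer to the modified chain. A cycle avoiding
  \<open>g\<close> that passes through \<open>\<Gamma>\<close> has probability 0 there, since
  \<open>\<Gamma>\<close> leads only to \<open>g\<close>; cycles outside \<open>\<Gamma>\<close>
  have the same probability in both chains.\<close>

sublocale rare_event_chain p' \<epsilon>\<^sub>0 g t "L \<union> G"
proof
  show "\<epsilon>\<^sub>0 > 0" by (rule eps0)
  show "(\<forall>\<epsilon>. 0 < \<epsilon> \<and> \<epsilon> < \<epsilon>\<^sub>0 \<longrightarrow> pmf (p' \<epsilon> x) z = 0) \<or>
      ((\<forall>\<epsilon>. 0 < \<epsilon> \<and> \<epsilon> < \<epsilon>\<^sub>0 \<longrightarrow> pmf (p' \<epsilon> x) z > 0) \<and>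
       (\<exists>r::nat. is_Theta (\<lambda>\<epsilon>. pmf (p' \<epsilon> x) z) (\<lambda>\<epsilon>. \<epsilon> ^ r)))" for x z
  proof (cases "x \<in> G")
    case True
    have "is_Theta (\<lambda>\<epsilon>. 1) (\<lambda>\<epsilon>. \<epsilon> ^ 0)"
      by (auto simp: is_Theta_def intro!: exI[of _ 1])
    then have "\<exists>r. is_Theta (\<lambda>\<epsilon>. 1) (\<lambda>\<epsilon>. \<epsilon> ^ r)" ..
    then show ?thesis
      using True by (cases "z = g") (simp_all add: pbar_def)
  next
    case False
    then show ?thesis
      using transitions_p[of x z] by (simp add: pbar_def)
  qed
  show "finite (L \<union> G)"
    using finite_Lambda finite_Gamma by simp
  show "z \<in> L \<union> G" if "x \<in> L \<union> G" "x \<notin> {g, t}" "0 < \<epsilon>" "\<epsilon> < \<epsilon>\<^sub>0" "pmf (p' \<epsilon> x) z > 0" for \<epsilon> x z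
  proof (cases "x \<in> G")
    case True
    with that(5) have "z = g"
      by (auto simp: pbar_Gamma indicator_def split: if_splits)
    then show ?thesis by (simp add: goal_in_Lambda)
  next
    case False
    with that show ?thesis
      using successor_of_Lambda[of x \<epsilon> z] by (auto simp: pbar_Lambda)
  qed
  show "\<not> is_Theta (\<lambda>\<epsilon>. path_prob (p' \<epsilon>) \<omega>) (\<lambda>\<epsilon>. \<epsilon> ^ 0)"
    if \<omega>: "2 \<le> length \<omega>" "last \<omega> = hd \<omega>" "set \<omega> \<inter> {g, t} = {}" for \<omega>
  proof
    assume Theta: "is_Theta (\<lambda>\<epsilon>. path_prob (p' \<epsilon>) \<omega>) (\<lambda>\<epsilon>. \<epsilon> ^ 0)"
    show False
    proof (cases "set (butlast \<omega>) \<inter> G = {}")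
      case True
      with Theta have "set \<omega> = {g} \<or> set \<omega> = {t}"
        by (intro no_high_prob_cycle \<omega>(1,2)) (simp add: path_prob_pbar)
      with \<omega>(3) show False by auto
    next
      case False
      then have "path_prob (p' \<epsilon>) \<omega> = 0" for \<epsilon>
        using path_prob_pbar_Gamma \<omega>(3) by blast
      then have "\<forall>\<^sub>F \<epsilon>::real in at_right 0. False"
        using is_Theta_power_eventually_pos[OF Theta] by simp
      then show False
        by (simp add: trivial_limit_at_right_real)
    qed
  qed
qed

lemma Delta_eq: "\<Delta> p s g t x = dominant x"
  by (simp add: \<Delta>_def dominant_def dbar_def \<Phi>_def)

lemma v_eq: "v p s g t \<epsilon> x = val \<epsilon> x"
  by (simp add: v_def val_def Delta_eq)

lemma start_in_Lambda: "s \<in> L"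
proof -
  have "[s] \<in> paths_between g t s s"
    by (simp add: Cons_in_paths_between_iff)
  from path_dist_le[OF this, of p 0] have "path_dist p g t s s \<le> 0"
    using orig.path_order_singleton[of s 0] by (simp add: zero_enat_def del: path_prob_singleton)
  then show ?thesis
    by (simp add: \<Lambda>_def)
qed

text \<open>\<open>\<Gamma>\<close> lies outside \<open>\<Lambda>\<close>: merely reaching it from
  \<open>s\<close> has a higher order than reaching the goal.\<close>

lemma Gamma_far:
  assumes "x \<in> G" "\<omega> \<in> paths_between g t s x" "orig.path_order \<omega> r"
  shows "path_dist p g t s g < enat r"
proof -
  have "path_dist p g t s g < path_dist p g t s x"
    using assms(1) by (auto simp: \<Gamma>_def \<Lambda>_def)
  also have "\<dots> \<le> enat r"
    using assms(2,3) by (rule path_dist_le)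
  finally show ?thesis .
qed

text \<open>By \<open>Gamma_far\<close>, a prefix ending in \<open>\<Gamma>\<close> would exceed the
  total order of an optimal original path. Such a path thus avoids \<open>\<Gamma>\<close> and has
  the same probability in the modified chain.\<close>

lemma goal_dist_start: "goal_dist s \<le> path_dist p g t s g"
proof -
  from goal_reachable obtain d where d: "path_dist p g t s g = enat d"
    by auto
  from path_dist_attained[OF this] obtain \<omega> where
    \<omega>: "\<omega> \<in> paths_between g t s g" "orig.path_order \<omega> d"
    by metis
  have "x \<notin> G" if x: "x \<in> set (butlast \<omega>)" for x
  proof
    assume G: "x \<in> G"
    from x obtain xs ys where "butlast \<omega> = xs @ x # ys"
      by (meson split_list)
    moreover have "\<omega> \<noteq> []" using \<omega>(1) by auto
    ultimately have eq: "\<omega> = xs @ x # (ys @ [last \<omega>])"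
      using append_butlast_last_id[of \<omega>] by simp
    from \<omega>(1) have pre: "xs @ [x] \<in> paths_between g t s x"
      by (subst (asm) eq) (rule paths_between_prefix)
    from \<omega>(2) have "orig.path_order (xs @ x # (ys @ [last \<omega>])) d"
      by (subst (asm) eq)
    from orig.path_order_split[OF this] obtain a b where
      a: "orig.path_order (xs @ [x]) a" "d = a + b"
      by blast
    from Gamma_far[OF G pre a(1)] a(2) d show False
      by simp
  qed
  then have "set (butlast \<omega>) \<inter> G = {}"
    by blast
  then have "path_order \<omega> d"
    using \<omega>(2) by (simp add: path_prob_pbar)
  from path_dist_le[OF \<omega>(1) this] d show ?thesis
    by simp
qed

text \<open>Ensures that dominant paths from \<open>s\<close> are equally likely in both chains: a
  visit to \<open>\<Gamma>\<close> alone would cost more than \<open>goal_dist s\<close>.\<close>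

lemma dominant_avoids_Gamma:
  assumes "\<omega> \<in> dominant s"
  shows "set (butlast \<omega>) \<inter> G = {}"
proof (rule ccontr)
  assume "\<not> ?thesis"
  then have "\<exists>x\<in>set (butlast \<omega>). x \<in> G"
    by blast
  \<comment> \<open>The first visit is taken, so that both kernels agree on the prefix and
    \<open>Gamma_far\<close>, which is about the original chain, applies.\<close>
  from split_list_first_prop[OF this] obtain xs x ys where
    x: "butlast \<omega> = xs @ x # ys" "x \<in> G" "\<forall>y\<in>set xs. y \<notin> G"
    by blast
  from assms obtain n where \<omega>: "\<omega> \<in> paths_between g t s g" "goal_dist s = enat n" "path_order \<omega> n"
    by (auto simp: dominant_def)
  from \<omega>(1) have "\<omega> \<noteq> []" by auto
  then have eq: "\<omega> = xs @ x # (ys @ [last \<omega>])"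
    using append_butlast_last_id[of \<omega>] x(1) by simp
  from \<omega>(1) have pre: "xs @ [x] \<in> paths_between g t s x"
    by (subst (asm) eq) (rule paths_between_prefix)
  from \<omega>(3) have "path_order (xs @ x # (ys @ [last \<omega>])) n"
    by (subst (asm) eq)
  from path_order_split[OF this] obtain a b where a: "path_order (xs @ [x]) a" "n = a + b"
    by blast
  have "set (butlast (xs @ [x])) \<inter> G = {}"
    using x(3) by auto
  with a(1) have "orig.path_order (xs @ [x]) a"
    by (simp add: path_prob_pbar)
  from Gamma_far[OF x(2) pre this] goal_dist_start have "goal_dist s < enat a"
    by simp
  with \<omega>(2) a(2) show False
    by simp
qed

text \<open>The only possible step leads to \<open>g\<close> with probability 1. The state
  \<open>t\<close> is excluded: it may belong to \<open>\<Gamma>\<close>, but paths stop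
  there.\<close>

lemma goal_dist_Gamma:
  assumes "x \<in> G" "x \<noteq> t"
  shows "dominant x = {[x, g]}" "goal_dist x = 0"
proof -
  have x: "x \<notin> {g, t}"
    using assms goal_in_Lambda Lambda_Gamma_disjoint by auto
  have "step_order x g 0"
    using assms by (auto simp: pbar_Gamma is_Theta_def intro!: exI[of _ 1])
  from goal_dist_step[OF x this dominant_goal(2)[unfolded zero_enat_def]]
  show dist: "goal_dist x = 0"
    by (simp flip: zero_enat_def)
  have "(z, x) \<in> dom_edges \<longleftrightarrow> z = g" for z
  proof
    assume "(z, x) \<in> dom_edges"
    then obtain r where "step_order x z r"
      by (auto simp: dom_edges_def)
    moreover obtain \<epsilon> where "0 < \<epsilon>" "\<epsilon> < \<epsilon>\<^sub>0"
      using eps0 dense by blast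
    ultimately have "pmf (p' \<epsilon> x) z > 0"
      by (rule step_order_pos)
    with assms show "z = g"
      by (auto simp: pbar_Gamma indicator_def split: if_splits)
  next
    assume "z = g"
    have "\<exists>r m. step_order x g r \<and> goal_dist g = enat m \<and> goal_dist x = enat (r + m)"
      using \<open>step_order x g 0\<close> dist dominant_goal(2)
      by (intro exI[of _ 0]) (simp add: zero_enat_def)
    with \<open>z = g\<close> x assms show "(z, x) \<in> dom_edges"
      unfolding dom_edges_def by (simp add: goal_in_Lambda)
  qed
  with dominant_Cons[of x] x assms dominant_goal(1) show "dominant x = {[x, g]}"
    by simp
qed

lemma val_Gamma: "x \<in> G \<Longrightarrow> x \<noteq> t \<Longrightarrow> val \<epsilon> x = 1"
  by (simp add: val_def goal_dist_Gamma path_prob_Cons pbar_Gamma)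

section \<open>Path weights under the importance sampling measure\<close>

abbreviation "\<Q> \<equiv> Q_prob p s g t"

lemma less_exit_time_iff:
  "enat i < exit_time p s g t \<omega> \<longleftrightarrow> (\<forall>j\<le>i. j < length \<omega> \<longrightarrow> \<omega> ! j \<in> L \<and> \<omega> ! j \<noteq> g)"
  unfolding exit_time_def less_Inf_enat_iff by auto

lemma Q_prob_singleton [simp]: "\<Q> \<epsilon> [x] = 1"
  by (simp add: Q_prob_def)

lemma Q_prob_stopped:
  assumes "x \<notin> L \<or> x = g"
  shows "\<Q> \<epsilon> (x # l) = path_prob (p \<epsilon>) (x # l)"
proof -
  have "\<not> enat i < exit_time p s g t (x # l)" for i
    using assms unfolding less_exit_time_iff by force
  then show ?thesis
    by (simp add: Q_prob_def q_step_def path_prob_def)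
qed

text \<open>Inside \<open>\<Lambda>\<close> and away from \<open>g\<close>, removing the first state
  lowers the exit time by one. So \<open>\<Q>\<close> is Markovian there, as
  \<open>sum_paths_le_potential\<close> requires.\<close>

lemma Q_prob_Cons:
  assumes "x \<in> L" "x \<noteq> g" "l \<noteq> []"
  shows "\<Q> \<epsilon> (x # l) = pmf (p \<epsilon> x) (hd l) * val \<epsilon> (hd l) / succ_val \<epsilon> x * \<Q> \<epsilon> l"
proof -
  have exit: "enat (Suc i) < exit_time p s g t (x # l) \<longleftrightarrow> enat i < exit_time p s g t l" for i
    unfolding less_exit_time_iff using assms by (auto simp: nth_Cons split: nat.splits)
  have "enat 0 < exit_time p s g t (x # l)"
    unfolding less_exit_time_iff using assms by simp
  then have zero: "q_step p s g t \<epsilon> (x # l) 0 = pmf (p \<epsilon> x) (hd l) * val \<epsilon> (hd l) / succ_val \<epsilon> x"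
    using assms by (simp add: q_step_def v_eq succ_val_def pbar_Lambda hd_conv_nth)
  have Suc: "q_step p s g t \<epsilon> (x # l) (Suc i) = q_step p s g t \<epsilon> l i" for i
    by (simp add: q_step_def exit)
  from assms(3) obtain n where "length l = Suc n"
    by (cases l) auto
  then show ?thesis
    by (simp add: Q_prob_def prod.lessThan_Suc_shift zero Suc del: prod.lessThan_Suc)
qed

lemma succ_val_nonneg: "succ_val \<epsilon> x \<ge> 0"
  unfolding succ_val_def by (intro infsum_nonneg mult_nonneg_nonneg pmf_nonneg val_nonneg)

lemma Q_prob_nonneg: "\<Q> \<epsilon> \<omega> \<ge> 0"
  unfolding Q_prob_def q_step_def v_eq
  by (intro prod_nonneg) (auto intro!: divide_nonneg_nonneg mult_nonneg_nonneg infsum_nonneg val_nonneg)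

lemma sum_successors_le:
  fixes h :: "'a \<Rightarrow> real"
  assumes x: "x \<in> L" "x \<notin> {g, t}" and \<epsilon>: "0 < \<epsilon>" "\<epsilon> < \<epsilon>\<^sub>0" and h: "\<And>z. z \<in> L \<union> G \<Longrightarrow> 0 \<le> h z"
    and Z: "finite Z"
  shows "(\<Sum>z\<in>Z. pmf (p \<epsilon> x) z * h z) \<le> (\<Sum>z\<in>L \<union> G. pmf (p' \<epsilon> x) z * h z)"
proof -
  have "pmf (p \<epsilon> x) z = 0" if "z \<notin> L \<union> G" for z
    using successor_of_Lambda[OF x(1) \<epsilon>, of z] that pmf_nonneg[of "p \<epsilon> x" z] by linarith
  then have "(\<Sum>z\<in>Z. pmf (p \<epsilon> x) z * h z) = (\<Sum>z\<in>Z \<inter> (L \<union> G). pmf (p \<epsilon> x) z * h z)"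
    using Z by (intro sum.mono_neutral_right) auto
  also have "\<dots> \<le> (\<Sum>z\<in>L \<union> G. pmf (p \<epsilon> x) z * h z)"
    using finite_S h by (intro sum_mono2) auto
  finally show ?thesis
    using x by (simp add: pbar_Lambda)
qed

text \<open>The constant potential 1 works: up to the exit from \<open>\<Lambda>\<close> the step
  weights sum to at most 1, and afterwards \<open>sum_path_prob_le_1\<close> applies.\<close>

lemma sum_Q_prob_le_1:
  assumes \<epsilon>: "0 < \<epsilon>" "\<epsilon> < \<epsilon>\<^sub>0" and A: "finite A" "A \<subseteq> stopped_paths s g t"
  shows "sum (\<Q> \<epsilon>) A \<le> 1"
proof (rule sum_paths_le_potential[where N = "{g, t} \<union> - L" and B = "{g, t}" and h = "\<lambda>_. 1"
      and c = "\<lambda>x z. pmf (p \<epsilon> x) z * val \<epsilon> z / succ_val \<epsilon> x" and g = g and t = t and x = s])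
  show "finite A" "A \<subseteq> (\<Union>z\<in>{g, t}. paths_between g t s z)"
    using A by (auto simp: stopped_paths_def)
next
  fix x A assume x: "x \<in> {g, t} \<union> - L" and A: "finite A" "A \<subseteq> (\<Union>z\<in>{g, t}. paths_between g t x z)"
  have "\<omega> = x # tl \<omega>" if "\<omega> \<in> A" for \<omega>
    using A(2) that by (auto simp: paths_between_def)
  \<comment> \<open>\<open>t\<close> may belong to \<open>\<Lambda>\<close>; only the one-state path
    remains there, of weight 1 under both measures.\<close>
  moreover have "tl \<omega> = []" if "\<omega> \<in> A" "x \<in> {g, t}" for \<omega>
    using subsetD[OF paths_between_absorbed[OF that(2)] subsetD[OF A(2) that(1)]] by simp
  ultimately have "\<Q> \<epsilon> \<omega> = path_prob (p \<epsilon>) \<omega>" if "\<omega> \<in> A" for \<omega>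
    using x that Q_prob_stopped[of x \<epsilon> "tl \<omega>"] Q_prob_singleton path_prob_singleton
    by (metis ComplD UnE)
  then have "sum (\<Q> \<epsilon>) A = sum (path_prob (p \<epsilon>)) A"
    by (rule sum.cong[OF refl])
  also have "\<dots> \<le> 1"
    using A by (rule sum_path_prob_le_1)
  finally show "sum (\<Q> \<epsilon>) A \<le> 1" .
next
  fix x and Z :: "'a set" assume x: "x \<notin> {g, t} \<union> - L" and Z: "finite Z"
  have "(\<Sum>z\<in>Z. pmf (p \<epsilon> x) z * val \<epsilon> z) \<le> succ_val \<epsilon> x"
    using sum_successors_le[of x \<epsilon> "val \<epsilon>"] x \<epsilon> Z by (simp add: succ_val_eq_sum val_nonneg)
  \<comment> \<open>If the denominator is 0, division by 0 makes every weight 0.\<close>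
  then show "(\<Sum>z\<in>Z. pmf (p \<epsilon> x) z * val \<epsilon> z / succ_val \<epsilon> x * 1) \<le> 1"
    using succ_val_nonneg[of \<epsilon> x]
    by (cases "succ_val \<epsilon> x = 0") (simp_all flip: sum_divide_distrib add: divide_le_eq_1)
qed (auto simp: Q_prob_Cons val_nonneg succ_val_nonneg)

text \<open>Every state of a dominant path has finite goal distance and thus positive
  \<open>val\<close>, so no step weight vanishes. The likelihood ratio is then a genuine quotient on
  dominant paths.\<close>

lemma Q_prob_pos_dominant:
  assumes pos: "\<And>x. x \<in> L \<union> G \<Longrightarrow> goal_dist x \<noteq> \<infinity> \<Longrightarrow> val \<epsilon> x > 0" and \<epsilon>: "0 < \<epsilon>" "\<epsilon> < \<epsilon>\<^sub>0"
    and "\<omega> \<in> dominant x" "x \<in> L \<union> G" "set (butlast \<omega>) \<inter> G = {}"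
  shows "\<Q> \<epsilon> \<omega> > 0"
  using assms(4-)
proof (induction \<omega> arbitrary: x)
  case (Cons y l)
  have [simp]: "y = x"
    using Cons.prems(1) by (auto simp: dominant_def paths_between_def)
  show ?case
  proof (cases "l = []")
    case False
    with Cons.prems(1) have x: "x \<notin> {g, t}"
      by (auto simp: dominant_def Cons_in_paths_between_iff)
    with Cons.prems obtain z where z: "(z, x) \<in> dom_edges" "l \<in> dominant z"
      by (auto simp: dominant_Cons)
    then have hd: "hd l = z"
      by (auto simp: dominant_def paths_between_def)
    have xL: "x \<in> L"
      using Cons.prems False by auto
    from z(1) have zS: "z \<in> L \<union> G" and "goal_dist z \<noteq> \<infinity>" and "\<exists>r. step_order x z r"
      by (auto simp: dom_edges_def)
    then have "val \<epsilon> z > 0" "pmf (p' \<epsilon> x) z > 0"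
      using pos step_order_pos \<epsilon> by auto
    then have "0 < pmf (p' \<epsilon> x) z * val \<epsilon> z"
      by simp
    also have "\<dots> \<le> (\<Sum>z\<in>L \<union> G. pmf (p' \<epsilon> x) z * val \<epsilon> z)"
      using finite_S zS by (intro member_le_sum) (auto simp: val_nonneg)
    also have "\<dots> = succ_val \<epsilon> x"
      using Cons.prems x \<epsilon> by (simp add: succ_val_eq_sum)
    finally have "succ_val \<epsilon> x > 0" .
    moreover have "\<Q> \<epsilon> l > 0"
      using Cons.prems False by (intro Cons.IH[OF z(2) zS]) auto
    ultimately show ?thesis
      using \<open>val \<epsilon> z > 0\<close> \<open>pmf (p' \<epsilon> x) z > 0\<close> x xL False hd by (simp add: Q_prob_Cons pbar_Lambda)
  qed simp
qed (auto simp: dominant_def)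

text \<open>A possible successor at finite distance would make the distance of \<open>x\<close>
  finite, so every term vanishes.\<close>

lemma succ_val_infinite_dist:
  assumes x: "x \<in> L" "x \<notin> {g, t}" "goal_dist x = \<infinity>" and \<epsilon>: "0 < \<epsilon>" "\<epsilon> < \<epsilon>\<^sub>0"
  shows "succ_val \<epsilon> x = 0"
proof -
  have "pmf (p' \<epsilon> x) z * val \<epsilon> z = 0" for z
  proof (cases "pmf (p' \<epsilon> x) z = 0")
    case False
    then have "pmf (p' \<epsilon> x) z > 0"
      using pmf_nonneg[of "p' \<epsilon> x" z] by linarith
    from step_order_exists[OF \<epsilon> this] obtain r where "step_order x z r" ..
    from goal_dist_step[OF x(2) this] x(3) have "goal_dist z = \<infinity>"
      by (cases "goal_dist z") auto
    then show ?thesis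
      by (simp add: val_infinite_dist)
  qed simp
  then show ?thesis
    by (simp only: succ_val_def infsum_0_simp)
qed

text \<open>Up to the exit from \<open>\<Lambda>\<close> the summand is a product of the step weights \<open>p x z * succ_val x / val z\<close>,
  for which \<open>val\<^sup>2 * (1 + \<eta> * rank)\<close> is superharmonic. Where \<open>\<Q>\<close> vanishes, division by 0 makes both
  the summand and the product 0, so no positivity is needed.\<close>

lemma second_moment_bound:
  fixes \<eta> :: real
  assumes \<epsilon>: "0 < \<epsilon>" "\<epsilon> < \<epsilon>\<^sub>0" and \<eta>: "\<eta> \<ge> 0"
    and potential: "\<And>x. x \<in> L \<Longrightarrow> x \<notin> {g, t} \<Longrightarrow> goal_dist x \<noteq> \<infinity> \<Longrightarrow>
      succ_val \<epsilon> x / val \<epsilon> x * (\<Sum>z\<in>L \<union> G. pmf (p' \<epsilon> x) z * (val \<epsilon> z * (1 + \<eta> * rank z))) \<le>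
      val \<epsilon> x * (1 + \<eta> * rank x)"
    and pos: "\<And>x. x \<in> L \<union> G \<Longrightarrow> goal_dist x \<noteq> \<infinity> \<Longrightarrow> val \<epsilon> x > 0"
    and A: "finite A" "A \<subseteq> \<Phi> g t s"
  shows "(\<Sum>\<omega>\<in>A. (path_prob (p \<epsilon>) \<omega>)\<^sup>2 / \<Q> \<epsilon> \<omega>) \<le> (val \<epsilon> s)\<^sup>2 * (1 + \<eta> * rank s)"
proof -
  define k where "k x = 1 + \<eta> * rank x" for x
  \<comment> \<open>Outside \<open>\<Lambda> \<union> \<Gamma>\<close> the value 1 is the trivial
    bound on the total probability of stopped paths.\<close>
  define h where "h x = (if x \<in> L \<union> G then (val \<epsilon> x)\<^sup>2 * k x else 1)" for x
  have k: "k x \<ge> 1" for x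
    using \<eta> by (simp add: k_def)
  have "(\<Sum>\<omega>\<in>A. (path_prob (p \<epsilon>) \<omega>)\<^sup>2 / \<Q> \<epsilon> \<omega>) \<le> h s"
  proof (rule sum_paths_le_potential[where N = "{g, t} \<union> - L" and B = "{g}" and h = h
      and c = "\<lambda>x z. pmf (p \<epsilon> x) z * succ_val \<epsilon> x / val \<epsilon> z" and g = g and t = t and x = s])
    show "finite A" "A \<subseteq> (\<Union>z\<in>{g}. paths_between g t s z)"
      using A by (auto simp: \<Phi>_def)
  next
    fix x A assume x: "x \<in> {g, t} \<union> - L" and A: "finite A" "A \<subseteq> (\<Union>z\<in>{g}. paths_between g t x z)"
    show "(\<Sum>\<omega>\<in>A. (path_prob (p \<epsilon>) \<omega>)\<^sup>2 / \<Q> \<epsilon> \<omega>) \<le> h x"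
    proof (cases "x = t \<and> x \<noteq> g")
      case True
      have "[x] \<notin> paths_between g t x g"
        using True by (auto simp: paths_between_def)
      moreover have "A \<subseteq> {[x]}"
        using A(2) paths_between_absorbed[of x g t "{g}"] x True by (meson insertCI subset_trans)
      ultimately have "A = {}"
        using A(2) by auto
      moreover have "0 \<le> h x"
        using k[of x] by (simp add: h_def)
      ultimately show ?thesis by simp
    next
      case False
      with x have stopped: "x \<notin> L \<or> x = g" by auto
      \<comment> \<open>Here \<open>\<Q>\<close> equals the path probability, so the summand reduces
        to it, also when both are 0.\<close>
      have "(path_prob (p \<epsilon>) \<omega>)\<^sup>2 / \<Q> \<epsilon> \<omega> = path_prob (p \<epsilon>) \<omega>" if "\<omega> \<in> A" for \<omega>
      proof -
        have "\<omega> = x # tl \<omega>"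
          using A(2) that by (auto simp: paths_between_def)
        then have "\<Q> \<epsilon> \<omega> = path_prob (p \<epsilon>) \<omega>"
          using Q_prob_stopped[OF stopped] by metis
        then show ?thesis by (simp add: power2_eq_square)
      qed
      then have "(\<Sum>\<omega>\<in>A. (path_prob (p \<epsilon>) \<omega>)\<^sup>2 / \<Q> \<epsilon> \<omega>) = sum (path_prob (p \<epsilon>)) A"
        by (rule sum.cong[OF refl])
      also have "\<dots> \<le> 1"
        using A by (intro sum_path_prob_le_1[where g = g and t = t]) auto
      also have "1 \<le> h x"
      proof (cases "x \<in> L \<union> G")
        case True
        then have "val \<epsilon> x = 1"
          using stopped False val_goal val_Gamma by (cases "x = g") auto
        with k[of x] show ?thesis
          by (simp add: h_def)
      qed (simp add: h_def)
      finally show ?thesis .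
    qed
  next
    fix x and l :: "'a list" assume x: "x \<notin> {g, t} \<union> - L" and l: "l \<noteq> []"
    then show "(path_prob (p \<epsilon>) (x # l))\<^sup>2 / \<Q> \<epsilon> (x # l) =
        pmf (p \<epsilon> x) (hd l) * succ_val \<epsilon> x / val \<epsilon> (hd l) * ((path_prob (p \<epsilon>) l)\<^sup>2 / \<Q> \<epsilon> l)"
      by (simp add: Q_prob_Cons path_prob_Cons power2_eq_square)
  next
    fix x and Z :: "'a set" assume x: "x \<notin> {g, t} \<union> - L" and Z: "finite Z"
    \<comment> \<open>One factor \<open>val \<epsilon> z\<close> of the square in \<open>h z\<close>
      cancels; where it is 0, both sides are 0.\<close>
    have eq: "pmf (p \<epsilon> x) z * succ_val \<epsilon> x / val \<epsilon> z * h z =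
        succ_val \<epsilon> x * (pmf (p \<epsilon> x) z * (val \<epsilon> z * k z))" for z
    proof (cases "z \<in> L \<union> G")
      case False
      then have "pmf (p \<epsilon> x) z = 0"
        using successor_of_Lambda[of x \<epsilon> z] x \<epsilon> pmf_nonneg[of "p \<epsilon> x" z] by force
      then show ?thesis by simp
    next
      case True
      then show ?thesis by (simp add: h_def power2_eq_square)
    qed
    have "(\<Sum>z\<in>Z. pmf (p \<epsilon> x) z * succ_val \<epsilon> x / val \<epsilon> z * h z) =
        succ_val \<epsilon> x * (\<Sum>z\<in>Z. pmf (p \<epsilon> x) z * (val \<epsilon> z * k z))"
      unfolding eq by (simp add: sum_distrib_left)
    also have "\<dots> \<le> succ_val \<epsilon> x * (\<Sum>z\<in>L \<union> G. pmf (p' \<epsilon> x) z * (val \<epsilon> z * k z))"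
    proof (intro mult_left_mono sum_successors_le succ_val_nonneg Z \<epsilon>)
      show "0 \<le> val \<epsilon> z * k z" for z
        using k[of z] by (simp add: val_nonneg)
    qed (use x in auto)
    also have "\<dots> \<le> h x"
    proof (cases "goal_dist x = \<infinity>")
      case True
      then show ?thesis
        using x \<epsilon> by (simp add: succ_val_infinite_dist h_def val_infinite_dist)
    next
      case False
      then have pos: "val \<epsilon> x > 0"
        using x pos by auto
      have "succ_val \<epsilon> x * (\<Sum>z\<in>L \<union> G. pmf (p' \<epsilon> x) z * (val \<epsilon> z * k z)) =
          val \<epsilon> x * (succ_val \<epsilon> x / val \<epsilon> x * (\<Sum>z\<in>L \<union> G. pmf (p' \<epsilon> x) z * (val \<epsilon> z * k z)))"
        using pos by simp
      also have "\<dots> \<le> val \<epsilon> x * (val \<epsilon> x * k x)"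
        using potential[of x] x False pos unfolding k_def by (intro mult_left_mono) auto
      also have "\<dots> = h x"
        using x by (simp add: h_def power2_eq_square)
      finally show ?thesis .
    qed
    finally show "(\<Sum>z\<in>Z. pmf (p \<epsilon> x) z * succ_val \<epsilon> x / val \<epsilon> z * h z) \<le> h x" .
  qed (auto simp: val_nonneg succ_val_nonneg)
  then show ?thesis
    using start_in_Lambda by (simp add: h_def k_def)
qed

section \<open>Law of the random path and moments of the estimator\<close>

lemma nn_integral_Q_law:
  assumes "f None = 0"
  shows "(\<integral>\<^sup>+w. f w \<partial>Q_law p s g t \<epsilon>) =
    (\<integral>\<^sup>+\<omega>. ennreal (\<Q> \<epsilon> \<omega>) * f (Some \<omega>) \<partial>count_space (stopped_paths s g t))"
proof -
  let ?d = "\<lambda>w. case w of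
        None \<Rightarrow> 1 - (\<integral>\<^sup>+\<omega>. ennreal (\<Q> \<epsilon> \<omega>) \<partial>count_space (stopped_paths s g t))
      | Some \<omega> \<Rightarrow> if \<omega> \<in> stopped_paths s g t then ennreal (\<Q> \<epsilon> \<omega>) else 0"
  have "(\<integral>\<^sup>+w. f w \<partial>Q_law p s g t \<epsilon>) = (\<integral>\<^sup>+w. ?d w * f w \<partial>count_space UNIV)"
    unfolding Q_law_def point_measure_def by (rule nn_integral_density) auto
  \<comment> \<open>As \<open>f\<close> vanishes at \<open>None\<close>, the mass of the runs that
    never stop drops out.\<close>
  also have "\<dots> = (\<integral>\<^sup>+w. ?d w * f w \<partial>count_space (Some ` stopped_paths s g t))"
    using assms by (intro nn_integral_count_space_eq) (auto split: option.splits)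
  also have "\<dots> = (\<integral>\<^sup>+\<omega>. ?d (Some \<omega>) * f (Some \<omega>) \<partial>count_space (stopped_paths s g t))"
    by (intro nn_integral_bij_count_space[symmetric]) (auto simp: bij_betw_def)
  also have "\<dots> = (\<integral>\<^sup>+\<omega>. ennreal (\<Q> \<epsilon> \<omega>) * f (Some \<omega>) \<partial>count_space (stopped_paths s g t))"
    by (intro nn_integral_cong) auto
  finally show ?thesis .
qed

lemma prob_space_Q_law:
  assumes "0 < \<epsilon>" "\<epsilon> < \<epsilon>\<^sub>0"
  shows "prob_space (Q_law p s g t \<epsilon>)"
proof
  let ?M = "Q_law p s g t \<epsilon>"
  let ?total = "\<integral>\<^sup>+\<omega>. ennreal (\<Q> \<epsilon> \<omega>) \<partial>count_space (stopped_paths s g t)"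
  have sets: "sets ?M = UNIV" "space ?M = UNIV"
    by (simp_all add: Q_law_def sets_point_measure space_point_measure)
  \<comment> \<open>Subtraction in \<open>ennreal\<close> is truncated at 0; this bound makes the
    two masses add up to exactly 1.\<close>
  have "?total \<le> ennreal 1"
    by (intro nn_integral_count_space_le Q_prob_nonneg sum_Q_prob_le_1 assms)
  then have total: "?total \<le> 1" by simp
  have "emeasure ?M (range Some) = (\<integral>\<^sup>+w. indicator (range Some) w \<partial>?M)"
    by (simp add: sets)
  also have "\<dots> = ?total"
    by (subst nn_integral_Q_law) (auto intro!: nn_integral_cong)
  finally have Some: "emeasure ?M (range Some) = ?total" .
  have "emeasure ?M {None} = 1 - ?total"
    unfolding Q_law_def by (subst emeasure_point_measure_finite2) auto
  moreover have "emeasure ?M (space ?M) = emeasure ?M {None} + emeasure ?M (range Some)"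
    by (subst plus_emeasure) (auto simp: sets UNIV_option_conv)
  ultimately show "emeasure ?M (space ?M) = 1"
    using Some total by (simp add: diff_add_cancel_ennreal)
qed

text \<open>The comparison of the two moments for one fixed \<epsilon>; all asymptotics sit in
  \<open>potential\<close> and \<open>pos\<close>.\<close>

lemma relative_variance_bound:
  fixes \<eta> :: real
  assumes \<epsilon>: "0 < \<epsilon>" "\<epsilon> < \<epsilon>\<^sub>0" and \<eta>: "\<eta> \<ge> 0"
    and potential: "\<And>x. x \<in> L \<Longrightarrow> x \<notin> {g, t} \<Longrightarrow> goal_dist x \<noteq> \<infinity> \<Longrightarrow>
      succ_val \<epsilon> x / val \<epsilon> x * (\<Sum>z\<in>L \<union> G. pmf (p' \<epsilon> x) z * (val \<epsilon> z * (1 + \<eta> * rank z))) \<le>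
      val \<epsilon> x * (1 + \<eta> * rank x)"
    and pos: "\<And>x. x \<in> L \<union> G \<Longrightarrow> goal_dist x \<noteq> \<infinity> \<Longrightarrow> val \<epsilon> x > 0"
  shows "variance_Q p s g t \<epsilon> (estimator p s g t \<epsilon>) /
      ennreal ((expectation_Q p s g t \<epsilon> (estimator p s g t \<epsilon>))\<^sup>2) \<le> ennreal (\<eta> * rank s)"
proof -
  define M where "M = Q_law p s g t \<epsilon>"
  define X where "X = estimator p s g t \<epsilon>"
  define k where "k = 1 + \<eta> * rank s"
  interpret M: prob_space M
    unfolding M_def by (rule prob_space_Q_law[OF \<epsilon>])
  have X_meas [measurable]: "X \<in> borel_measurable M"
    by (simp add: M_def Q_law_def)
  have X_nonneg: "X w \<ge> 0" for w
    by (auto simp: X_def estimator_def likelihood_ratio_def path_prob_nonneg Q_prob_nonneg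
        split: option.splits)
  have Phi_sub: "\<Phi> g t s \<subseteq> stopped_paths s g t"
    by (auto simp: \<Phi>_def stopped_paths_def)
  have "(\<integral>\<^sup>+w. ennreal ((X w)\<^sup>2) \<partial>M) =
      (\<integral>\<^sup>+\<omega>. ennreal (\<Q> \<epsilon> \<omega>) * ennreal ((X (Some \<omega>))\<^sup>2) \<partial>count_space (stopped_paths s g t))"
    unfolding M_def by (rule nn_integral_Q_law) (simp add: X_def estimator_def)
  also have "\<dots> = (\<integral>\<^sup>+\<omega>. ennreal (\<Q> \<epsilon> \<omega>) * ennreal ((X (Some \<omega>))\<^sup>2) \<partial>count_space (\<Phi> g t s))"
    using Phi_sub by (intro nn_integral_count_space_eq) (auto simp: X_def estimator_def)
  also have "\<dots> = (\<integral>\<^sup>+\<omega>. ennreal ((path_prob (p \<epsilon>) \<omega>)\<^sup>2 / \<Q> \<epsilon> \<omega>) \<partial>count_space (\<Phi> g t s))"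
    by (intro nn_integral_cong)
       (auto simp: X_def estimator_def likelihood_ratio_def power2_eq_square Q_prob_nonneg
         simp flip: ennreal_mult')
  also have "\<dots> \<le> ennreal ((val \<epsilon> s)\<^sup>2 * k)"
    unfolding k_def using assms
    by (intro nn_integral_count_space_le second_moment_bound) (auto simp: Q_prob_nonneg)
  finally have second: "(\<integral>\<^sup>+w. ennreal ((X w)\<^sup>2) \<partial>M) \<le> ennreal ((val \<epsilon> s)\<^sup>2 * k)" .
  have int2: "integrable M (\<lambda>w. (X w)\<^sup>2)"
    using second by (intro integrableI_nonneg) (auto intro: le_less_trans)
  \<comment> \<open>On a probability space square integrability implies integrability, so the
    Bochner integrals below are actual moments and not the default value 0.\<close>
  then have int: "integrable M X"
    by (rule M.square_integrable_imp_integrable[OF X_meas])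
  define \<mu> where "\<mu> = M.expectation X"
  have "0 \<le> k"
    using \<eta> by (simp add: k_def)
  have E2: "M.expectation (\<lambda>w. (X w)\<^sup>2) \<le> (val \<epsilon> s)\<^sup>2 * k"
    using second \<open>0 \<le> k\<close> by (simp add: nn_integral_eq_integral int2)

  have dom: "path_prob (p' \<epsilon>) \<omega> = \<Q> \<epsilon> \<omega> * X (Some \<omega>)" "\<omega> \<in> stopped_paths s g t"
    if "\<omega> \<in> dominant s" for \<omega>
  proof -
    from that have "\<omega> \<in> \<Phi> g t s"
      by (simp add: dominant_def \<Phi>_def)
    then show "\<omega> \<in> stopped_paths s g t"
      using Phi_sub by blast
    have "\<Q> \<epsilon> \<omega> > 0"
      using Q_prob_pos_dominant[OF pos \<epsilon> that] start_in_Lambda dominant_avoids_Gamma[OF that]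
      by simp
    then show "path_prob (p' \<epsilon>) \<omega> = \<Q> \<epsilon> \<omega> * X (Some \<omega>)"
      using \<open>\<omega> \<in> \<Phi> g t s\<close>
      by (simp add: X_def estimator_def likelihood_ratio_def path_prob_pbar dominant_avoids_Gamma[OF that])
  qed
  \<comment> \<open>The dominant paths alone already contribute \<open>val \<epsilon> s\<close> to
    the mean.\<close>
  have "ennreal (val \<epsilon> s) = ennreal (\<Sum>\<omega>\<in>dominant s. \<Q> \<epsilon> \<omega> * X (Some \<omega>))"
    using start_in_Lambda dom(1) by (simp add: val_eq_sum)
  also have "\<dots> \<le> (\<integral>\<^sup>+\<omega>. ennreal (\<Q> \<epsilon> \<omega> * X (Some \<omega>)) \<partial>count_space (stopped_paths s g t))"
    using start_in_Lambda dom(2) Q_prob_nonneg X_nonneg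
    by (intro sum_le_nn_integral_count_space) (auto simp: finite_dominant)
  also have "\<dots> = (\<integral>\<^sup>+w. ennreal (X w) \<partial>M)"
    unfolding M_def
    by (subst nn_integral_Q_law) (auto simp: X_def estimator_def ennreal_mult' Q_prob_nonneg)
  also have "\<dots> = ennreal \<mu>"
    unfolding \<mu>_def using int X_nonneg by (intro nn_integral_eq_integral) auto
  finally have val_le: "ennreal (val \<epsilon> s) \<le> ennreal \<mu>" .
  have "goal_dist s \<noteq> \<infinity>"
    using goal_dist_start goal_reachable by (metis enat_ord_simps(6) le_less_trans less_irrefl)
  then have val_pos: "val \<epsilon> s > 0"
    using pos start_in_Lambda by simp
  \<comment> \<open>Since \<open>ennreal\<close> sends negative reals to 0, positivity of
    \<open>val\<close> is what carries the inequality back to the reals.\<close>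
  with val_le have \<mu>: "val \<epsilon> s \<le> \<mu>" "\<mu> > 0"
    by (auto simp: ennreal_le_iff2)

  have "variance_Q p s g t \<epsilon> X = (\<integral>\<^sup>+w. ennreal ((X w - \<mu>)\<^sup>2) \<partial>M)"
    by (simp add: variance_Q_def expectation_Q_def M_def \<mu>_def)
  also have "\<dots> = ennreal (M.variance X)"
  proof -
    have "integrable M (\<lambda>w. (X w - \<mu>)\<^sup>2)"
      unfolding power2_diff using int int2 by auto
    then show ?thesis
      unfolding \<mu>_def by (rule nn_integral_eq_integral) simp
  qed
  also have "M.variance X = M.expectation (\<lambda>w. (X w)\<^sup>2) - \<mu>\<^sup>2"
    unfolding \<mu>_def using int int2 by (rule M.variance_eq)
  also have "ennreal \<dots> \<le> ennreal (\<mu>\<^sup>2 * (\<eta> * rank s))"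
  proof (rule ennreal_leI)
    have "(val \<epsilon> s)\<^sup>2 * k \<le> \<mu>\<^sup>2 * k"
      using \<mu> val_pos \<open>0 \<le> k\<close> by (intro mult_right_mono power_mono) auto
    with E2 show "M.expectation (\<lambda>w. (X w)\<^sup>2) - \<mu>\<^sup>2 \<le> \<mu>\<^sup>2 * (\<eta> * rank s)"
      by (simp add: k_def algebra_simps)
  qed
  finally have "variance_Q p s g t \<epsilon> X / ennreal (\<mu>\<^sup>2) \<le>
      ennreal (\<mu>\<^sup>2 * (\<eta> * rank s)) / ennreal (\<mu>\<^sup>2)"
    by (rule divide_right_mono_ennreal)
  also have "\<dots> = ennreal (\<eta> * rank s)"
    using \<mu> \<eta> by (subst divide_ennreal) auto
  finally show ?thesis
    by (simp add: X_def \<mu>_def expectation_Q_def M_def)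
qed

text \<open>Finiteness of \<open>\<Lambda>\<close> and \<open>\<Gamma>\<close> merges the eventual
  statements for single states into one threshold for \<epsilon>.\<close>

lemma eventually_relative_variance:
  fixes \<eta> :: real
  assumes \<eta>: "\<eta> > 0"
  shows "\<forall>\<^sub>F \<epsilon> in at_right 0. variance_Q p s g t \<epsilon> (estimator p s g t \<epsilon>) /
      ennreal ((expectation_Q p s g t \<epsilon> (estimator p s g t \<epsilon>))\<^sup>2) \<le> ennreal (\<eta> * rank s)"
proof -
  have "\<forall>\<^sub>F \<epsilon> in at_right 0. \<forall>x\<in>L - {g, t}. goal_dist x \<noteq> \<infinity> \<longrightarrow>
      succ_val \<epsilon> x / val \<epsilon> x * (\<Sum>z\<in>L \<union> G. pmf (p' \<epsilon> x) z * (val \<epsilon> z * (1 + \<eta> * rank z))) \<le>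
      val \<epsilon> x * (1 + \<eta> * rank x)"
  proof (intro eventually_ball_finite ballI)
    fix x assume x: "x \<in> L - {g, t}"
    show "\<forall>\<^sub>F \<epsilon> in at_right 0. goal_dist x \<noteq> \<infinity> \<longrightarrow>
      succ_val \<epsilon> x / val \<epsilon> x * (\<Sum>z\<in>L \<union> G. pmf (p' \<epsilon> x) z * (val \<epsilon> z * (1 + \<eta> * rank z))) \<le>
      val \<epsilon> x * (1 + \<eta> * rank x)"
    proof (cases "goal_dist x")
      case (enat n)
      show ?thesis
        using eventually_potential[OF _ _ enat \<eta>] x by (auto elim: eventually_mono)
    qed simp
  qed (simp add: finite_Lambda)
  moreover have "\<forall>\<^sub>F \<epsilon> in at_right 0. \<forall>x\<in>L \<union> G. goal_dist x \<noteq> \<infinity> \<longrightarrow> val \<epsilon> x > 0"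
  proof (intro eventually_ball_finite ballI)
    fix x assume x: "x \<in> L \<union> G"
    show "\<forall>\<^sub>F \<epsilon> in at_right 0. goal_dist x \<noteq> \<infinity> \<longrightarrow> val \<epsilon> x > 0"
    proof (cases "goal_dist x")
      case (enat n)
      show ?thesis
        using is_Theta_power_eventually_pos[OF val_Theta[OF x enat]] by (rule eventually_mono) simp
    qed simp
  qed (rule finite_S)
  ultimately show ?thesis
    using eventually_small
  proof eventually_elim
    case (elim \<epsilon>)
    then show ?case
      using \<eta> by (intro relative_variance_bound) auto
  qed
qed

lemma vanishing_relative_error:
  "((\<lambda>\<epsilon>. variance_Q p s g t \<epsilon> (estimator p s g t \<epsilon>) /
      ennreal ((expectation_Q p s g t \<epsilon> (estimator p s g t \<epsilon>))\<^sup>2)) \<longlongrightarrow> 0) (at_right 0)"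
proof (rule order_tendstoI)
  fix a :: ennreal assume "0 < a"
  \<comment> \<open>The bound \<open>a\<close> may be infinite; a value strictly below it is finite
    and leaves room for the strict inequality.\<close>
  then obtain b where b: "0 < b" "b < a"
    using dense by blast
  then obtain \<delta> where \<delta>: "b = ennreal \<delta>" "\<delta> > 0"
    by (cases b) auto
  \<comment> \<open>\<open>rank s\<close> does not depend on \<epsilon>, so \<open>\<eta>\<close> is
    a legitimate constant; adding 1 avoids division by 0.\<close>
  define \<eta> where "\<eta> = \<delta> / (rank s + 1)"
  have "\<eta> > 0" "\<eta> * rank s \<le> \<delta>"
    using \<delta> by (simp_all add: \<eta>_def field_simps)
  from eventually_relative_variance[OF this(1)] show "\<forall>\<^sub>F \<epsilon> in at_right 0.
      variance_Q p s g t \<epsilon> (estimator p s g t \<epsilon>) /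
      ennreal ((expectation_Q p s g t \<epsilon> (estimator p s g t \<epsilon>))\<^sup>2) < a"
  proof eventually_elim
    case (elim \<epsilon>)
    also have "ennreal (\<eta> * rank s) \<le> b"
      using \<open>\<eta> * rank s \<le> \<delta>\<close> \<delta> by (simp add: ennreal_leI)
    finally show ?case
      using b(2) by simp
  qed
qed simp

end

theorem theorem4p6:
  fixes p :: "real \<Rightarrow> 'a::countable \<Rightarrow> 'a pmf"
    and s g t :: 'a
    and \<epsilon>\<^sub>0 :: real
  assumes eps0: "\<epsilon>\<^sub>0 > 0"
    and s_neq_g: "s \<noteq> g"
    and s_neq_t: "s \<noteq> t"
    and absorbing_g: "\<And>\<epsilon>. 0 < \<epsilon> \<Longrightarrow> \<epsilon> < \<epsilon>\<^sub>0 \<Longrightarrow> pmf (p \<epsilon> g) g = 1"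
    and absorbing_t: "\<And>\<epsilon>. 0 < \<epsilon> \<Longrightarrow> \<epsilon> < \<epsilon>\<^sub>0 \<Longrightarrow> pmf (p \<epsilon> t) t = 1"
    and transitions: "\<And>x z.
          (\<forall>\<epsilon>. 0 < \<epsilon> \<and> \<epsilon> < \<epsilon>\<^sub>0 \<longrightarrow> pmf (p \<epsilon> x) z = 0) \<or>
          ((\<forall>\<epsilon>. 0 < \<epsilon> \<and> \<epsilon> < \<epsilon>\<^sub>0 \<longrightarrow> pmf (p \<epsilon> x) z > 0) \<and>
           (\<exists>r::nat. is_Theta (\<lambda>\<epsilon>. pmf (p \<epsilon> x) z) (\<lambda>\<epsilon>. \<epsilon> ^ r)))"
    and finite_Lambda: "finite (\<Lambda> p s g t)"
    and finite_Gamma: "finite (\<Gamma> p s g t)"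
    and goal_reachable: "path_dist p g t s g < \<infinity>"
    and absorption: "\<And>\<epsilon>. 0 < \<epsilon> \<Longrightarrow> \<epsilon> < \<epsilon>\<^sub>0 \<Longrightarrow>
          ((\<lambda>\<omega>. path_prob (p \<epsilon>) \<omega>) has_sum 1) (stopped_paths s g t)"
    and no_high_prob_cycle: "\<And>\<omega>. length \<omega> \<ge> 2 \<Longrightarrow> last \<omega> = hd \<omega> \<Longrightarrow>
          is_Theta (\<lambda>\<epsilon>. path_prob (p \<epsilon>) \<omega>) (\<lambda>\<epsilon>. \<epsilon> ^ 0) \<Longrightarrow>
          set \<omega> = {g} \<or> set \<omega> = {t}"
  shows "((\<lambda>\<epsilon>. variance_Q p s g t \<epsilon> (estimator p s g t \<epsilon>) /
               ennreal ((expectation_Q p s g t \<epsilon> (estimator p s g t \<epsilon>))\<^sup>2)) \<longlongrightarrow> 0)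
         (at_right 0)"
proof -
  interpret importance_sampling p s g t \<epsilon>\<^sub>0
    by unfold_locales (fact eps0 transitions finite_Lambda finite_Gamma goal_reachable
      no_high_prob_cycle)+
  show ?thesis
    by (rule vanishing_relative_error)
qed

end
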